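(* Let $G$ be a virtually abelian group, let $H\leq G$ be any subgroup, let $S$ be any finite generating set of $G$, and let $\omega\colon S\to\{1,2,3,\ldots\}$ be any weight function. Then the weighted growth series of the set of right cosets $H\backslash G$, $$\sum_{n=0}^{\infty}\#\{Hg\in H\backslash G\mid \omega(Hg)=n\}\,z^n,$$ is a rational function.
   Context: A finite generating set $S$ of $G$ means a finite subset $S\subseteq G$ generating $G$ as a monoid; $S^*$ is the set of all finite words over $S$ (including the empty word). The weight of a word is $\omega(s_1s_2\cdots s_k)=\sum_{i=1}^k\omega(s_i)$, and the weight $\omega(g)$ of $g\in G$ is the minimal weight amongst all words in $S^*$ that represent $g$. The weight of a right coset $Hg$ is $\omega(Hg)=\min\{\omega(g')\mid g'\in Hg\}$, i.e. the minimal weight of a word representing an element of the coset. A formal power series is a rational function if it equals $p(z)/q(z)$ for some polynomials $p,q$ with integer coefficients. *)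

theory Defs
  imports
    "HOL-Algebra.Coset"
    "HOL-Computational_Algebra.Polynomial_FPS"
    "HOL-Computational_Algebra.Formal_Laurent_Series"
begin

definition virtually_abelian :: "('a, 'b) monoid_scheme \<Rightarrow> bool" where
  "virtually_abelian G \<longleftrightarrow>
     (\<exists>A. subgroup A G \<and> comm_group (G\<lparr>carrier := A\<rparr>) \<and> finite (rcosets\<^bsub>G\<^esub> A))"

definition word_eval :: "('a, 'b) monoid_scheme \<Rightarrow> 'a list \<Rightarrow> 'a" where
  "word_eval G w = foldr (\<lambda>s g. s \<otimes>\<^bsub>G\<^esub> g) w \<one>\<^bsub>G\<^esub>"

text \<open>Generation is as a monoid: inverses of elements of \<open>S\<close> may not be used as letters.\<close>

definition finite_generating_set :: "('a, 'b) monoid_scheme \<Rightarrow> 'a set \<Rightarrow> bool" where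
  "finite_generating_set G S \<longleftrightarrow>
     finite S \<and> S \<subseteq> carrier G \<and> (\<forall>g \<in> carrier G. \<exists>w \<in> lists S. word_eval G w = g)"

definition word_weight :: "('a \<Rightarrow> nat) \<Rightarrow> 'a list \<Rightarrow> nat" where
  "word_weight \<omega> w = (\<Sum>s\<leftarrow>w. \<omega> s)"

text \<open>
  On \<^typ>\<open>nat\<close> the infimum of a nonempty set is its minimum. The sets below are nonempty
  whenever \<open>S\<close> generates \<open>G\<close>, \<open>g \<in> carrier G\<close> and \<open>C\<close> is a coset.
\<close>

definition elt_weight :: "('a, 'b) monoid_scheme \<Rightarrow> 'a set \<Rightarrow> ('a \<Rightarrow> nat) \<Rightarrow> 'a \<Rightarrow> nat" where
  "elt_weight G S \<omega> g = Inf {word_weight \<omega> w | w. w \<in> lists S \<and> word_eval G w = g}"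

definition coset_weight :: "('a, 'b) monoid_scheme \<Rightarrow> 'a set \<Rightarrow> ('a \<Rightarrow> nat) \<Rightarrow> 'a set \<Rightarrow> nat" where
  "coset_weight G S \<omega> C = Inf {elt_weight G S \<omega> g | g. g \<in> C}"

text \<open>
  If \<open>S\<close> is a finite generating set and \<open>\<omega>\<close> is positive on \<open>S\<close>, only finitely many words
  have weight \<open>n\<close>, so the sets counted here are finite and \<^const>\<open>card\<close> is their true size.
\<close>

definition coset_growth_series ::
  "('a, 'b) monoid_scheme \<Rightarrow> 'a set \<Rightarrow> 'a set \<Rightarrow> ('a \<Rightarrow> nat) \<Rightarrow> rat fps" where
  "coset_growth_series G H S \<omega> =
     Abs_fps (\<lambda>n. of_nat (card {C \<in> rcosets\<^bsub>G\<^esub> H. coset_weight G S \<omega> C = n}))"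

text \<open>
  The quotient is taken in the field of formal Laurent series, where it is a genuine quotient
  for every \<open>q \<noteq> 0\<close>; division of \<^typ>\<open>rat fps\<close> would truncate when \<open>q\<close> has a larger
  order at \<open>0\<close> than \<open>p\<close>.
\<close>

definition rational_fps :: "rat fps \<Rightarrow> bool" where
  "rational_fps F \<longleftrightarrow>
     (\<exists>p q :: int poly. q \<noteq> 0 \<and>
        fps_to_fls F =
          fps_to_fls (fps_of_poly (map_poly of_int p)) / fps_to_fls (fps_of_poly (map_poly of_int q)))"

end

theory Submission
  imports Defs "HOL-Algebra.Divisibility"
begin

text \<open>
  Let \<open>A\<close> be an abelian subgroup of finite index and \<open>R\<close> a finite set with \<open>G = R A\<close>. Left
  multiplication by a letter sends \<open>r a\<close> to \<open>r' (b a)\<close> with \<open>r' \<in> R\<close> and \<open>b \<in> A\<close> depending only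
  on \<open>r\<close> and the letter. So words are walks in a finite graph whose edges are labelled by pairs
  (element of \<open>A\<close>, weight), and by Kleene's algorithm in the commutative monoid of labels the
  walks between two vertices have a semilinear set of labels. For fixed \<open>t\<close> the cosets \<open>H t a\<close>
  with \<open>a \<in> A\<close> correspond to \<open>A / (A \<inter> t\<^sup>-\<^sup>1 H t)\<close>, and the pairs (coset, \<open>n\<close>) such that the
  coset has weight at most \<open>n\<close> form a semilinear set. A semilinear set is a finite union of
  finitely generated modules \<open>F + M\<close> over finitely generated monoids; by Dickson's lemma these
  modules are closed under intersection, and a Hilbert--Serre induction on the generators of \<open>M\<close>
  shows that they have rational generating functions.
\<close>

section \<open>Rational power series\<close>

text \<open>Least weights are awkward to express by semilinear sets, but the condition that some
  word of weight at most \<open>n\<close> lands in a given coset is existential in the word. This is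
  why the region of pairs with weight at most \<open>n\<close> is used; multiplying its series by
  \<open>1 - X\<close> recovers the exact weights. Many words give the same pair, and pairs must be
  counted without multiplicity: a linear set can represent its elements in several ways, and linear
  pieces overlap. The Hilbert--Serre induction deals with the first difficulty; the second is why
  intersections are needed, for inclusion--exclusion. All modules are subsets of one cancellative
  monoid, so quotients become set differences and no rings occur. The weights serve as degrees:
  being positive, they leave finitely many elements in each degree and make the factors
  \<open>1 - X ^ d\<close> nonzero. Each double coset \<open>H t A\<close> has its own group of
  labels, so the final series is a finite sum over the distinct double cosets.\<close>

abbreviation rat_fps_of_poly :: "int poly \<Rightarrow> rat fps" where
  "rat_fps_of_poly p \<equiv> fps_of_poly (map_poly of_int p)"

lemma rat_fps_of_poly_mult: "rat_fps_of_poly (p * q) = rat_fps_of_poly p * rat_fps_of_poly q"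
  by (rule fps_ext) (simp add: fps_mult_nth coeff_mult atLeast0AtMost coeff_map_poly)

lemma rat_fps_of_poly_add: "rat_fps_of_poly (p + q) = rat_fps_of_poly p + rat_fps_of_poly q"
  by (rule fps_ext) (simp add: coeff_map_poly)

lemma rat_fps_of_poly_uminus: "rat_fps_of_poly (- p) = - rat_fps_of_poly p"
  by (rule fps_ext) (simp add: coeff_map_poly)

lemma rat_fps_of_poly_eq_0_iff: "rat_fps_of_poly p = 0 \<longleftrightarrow> p = 0"
  by (simp add: fps_eq_iff poly_eq_iff coeff_map_poly)

lemma rat_fps_of_poly_one_minus_monom:
  "rat_fps_of_poly (1 - monom 1 d) = 1 - fps_X ^ d"
  by (rule fps_ext) (simp add: coeff_map_poly)

text \<open>Clearing the denominator, which is a unit among Laurent series, leads back to power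
  series. The closure properties below then reduce to identities between products.\<close>

lemma rational_fps_iff:
  "rational_fps F \<longleftrightarrow> (\<exists>p q. q \<noteq> 0 \<and> rat_fps_of_poly q * F = rat_fps_of_poly p)"
proof -
  have "fps_to_fls F = fps_to_fls (rat_fps_of_poly p) / fps_to_fls (rat_fps_of_poly q)
        \<longleftrightarrow> rat_fps_of_poly q * F = rat_fps_of_poly p" if "q \<noteq> 0" for p q
  proof -
    have "fps_to_fls (rat_fps_of_poly q) \<noteq> 0"
      using that by (simp add: rat_fps_of_poly_eq_0_iff)
    then have "fps_to_fls F = fps_to_fls (rat_fps_of_poly p) / fps_to_fls (rat_fps_of_poly q)
        \<longleftrightarrow> fps_to_fls F * fps_to_fls (rat_fps_of_poly q) = fps_to_fls (rat_fps_of_poly p)"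
      by (rule nonzero_eq_divide_eq)
    also have "\<dots> \<longleftrightarrow> F * rat_fps_of_poly q = rat_fps_of_poly p"
      by (simp flip: fls_times_fps_to_fls)
    finally show ?thesis by (simp add: mult.commute)
  qed
  then show ?thesis by (simp add: rational_fps_def cong: conj_cong)
qed

lemma rational_fpsI:
  "q \<noteq> 0 \<Longrightarrow> rat_fps_of_poly q * F = rat_fps_of_poly p \<Longrightarrow> rational_fps F"
  unfolding rational_fps_iff by blast

lemma rational_fps_poly: "rational_fps (rat_fps_of_poly p)"
  by (rule rational_fpsI[of 1]) simp_all

lemma rational_fps_0 [simp]: "rational_fps 0"
  using rational_fps_poly[of 0] by simp

lemma rational_fps_add:
  assumes "rational_fps F" "rational_fps F'"
  shows "rational_fps (F + F')"
proof -
  obtain p q p' q' where q: "q \<noteq> 0" "q' \<noteq> 0"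
    and *: "rat_fps_of_poly q * F = rat_fps_of_poly p" "rat_fps_of_poly q' * F' = rat_fps_of_poly p'"
    using assms unfolding rational_fps_iff by blast
  have "rat_fps_of_poly (q * q') * (F + F')
      = rat_fps_of_poly q' * (rat_fps_of_poly q * F) + rat_fps_of_poly q * (rat_fps_of_poly q' * F')"
    by (simp add: rat_fps_of_poly_mult algebra_simps)
  also have "\<dots> = rat_fps_of_poly (q' * p + q * p')"
    by (simp only: * rat_fps_of_poly_mult rat_fps_of_poly_add)
  finally show ?thesis
    by (rule rational_fpsI[rotated]) (use q in simp)
qed

lemma rational_fps_mult:
  assumes "rational_fps F" "rational_fps F'"
  shows "rational_fps (F * F')"
proof -
  obtain p q p' q' where q: "q \<noteq> 0" "q' \<noteq> 0"
    and *: "rat_fps_of_poly q * F = rat_fps_of_poly p" "rat_fps_of_poly q' * F' = rat_fps_of_poly p'"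
    using assms unfolding rational_fps_iff by blast
  have "rat_fps_of_poly (q * q') * (F * F')
      = (rat_fps_of_poly q * F) * (rat_fps_of_poly q' * F')"
    by (simp add: rat_fps_of_poly_mult algebra_simps)
  also have "\<dots> = rat_fps_of_poly (p * p')"
    by (simp only: * rat_fps_of_poly_mult)
  finally show ?thesis
    by (rule rational_fpsI[rotated]) (use q in simp)
qed

lemma rational_fps_X_power: "rational_fps (fps_X ^ d)"
proof -
  have "rat_fps_of_poly (monom 1 d) = fps_X ^ d"
    by (rule fps_ext) (simp add: coeff_map_poly)
  then show ?thesis using rational_fps_poly by metis
qed

lemma rational_fps_uminus: "rational_fps F \<Longrightarrow> rational_fps (- F)"
  using rational_fps_mult[OF rational_fps_poly[of "- 1"], of F]
  by (simp add: rat_fps_of_poly_uminus)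

lemma rational_fps_diff: "rational_fps F \<Longrightarrow> rational_fps F' \<Longrightarrow> rational_fps (F - F')"
  using rational_fps_add[of F "- F'"] rational_fps_uminus by simp

lemma rational_fps_sum: "(\<And>i. i \<in> I \<Longrightarrow> rational_fps (f i)) \<Longrightarrow> rational_fps (\<Sum>i\<in>I. f i)"
  by (induction I rule: infinite_finite_induct) (auto intro: rational_fps_add)

text \<open>The factor is the image of an integer polynomial with constant coefficient 1, so it can
  be absorbed into the denominator; for \<open>d = 0\<close> it would vanish.\<close>

lemma rational_fps_cancel:
  assumes "d > 0" "rational_fps ((1 - fps_X ^ d) * F)"
  shows "rational_fps F"
proof -
  obtain p q where q: "q \<noteq> 0"
    and *: "rat_fps_of_poly q * ((1 - fps_X ^ d) * F) = rat_fps_of_poly p"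
    using assms unfolding rational_fps_iff by blast
  let ?c = "1 - monom 1 d :: int poly"
  have "coeff ?c 0 = 1" using assms by simp
  then have "?c \<noteq> 0" by (metis coeff_0 zero_neq_one)
  moreover have "rat_fps_of_poly (q * ?c) * F = rat_fps_of_poly p"
    using * by (simp only: rat_fps_of_poly_mult rat_fps_of_poly_one_minus_monom mult.assoc)
  ultimately show ?thesis
    using q rational_fpsI[of "q * ?c" F p] by simp
qed

section \<open>Dickson's lemma\<close>

lemma nat_seq_mono_subseq:
  fixes s :: "nat \<Rightarrow> nat"
  shows "\<exists>r :: nat \<Rightarrow> nat. strict_mono r \<and> mono (s \<circ> r)"
proof -
  obtain f where f: "strict_mono f" "monoseq (\<lambda>n. s (f n))"
    using seq_monosub[of s] by blast
  consider "mono (s \<circ> f)" | "antimono (s \<circ> f)"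
    using f(2) by (auto simp: monoseq_iff incseq_def decseq_def mono_def antimono_def)
  then show ?thesis
  proof cases
    case 2
    \<comment> \<open>\<open>N\<close> is an index at which the least value is attained; a
      decreasing sequence stays constant from there on.\<close>
    obtain N where N: "\<And>n. s (f N) \<le> s (f n)"
      using ex_has_least_nat[of "\<lambda>_. True" 0 "\<lambda>n. s (f n)"] by auto
    have const: "s (f n) = s (f N)" if "n \<ge> N" for n
      using N[of n] antimonoD[OF 2 that] by simp
    have "s (f (N + m)) \<le> s (f (N + n))" for m n
      using const[of "N + m"] const[of "N + n"] by simp
    then have "mono (s \<circ> (\<lambda>n. f (N + n)))" by (simp add: mono_def)
    moreover have "strict_mono (\<lambda>n. f (N + n))"
      using f(1) by (simp add: strict_mono_def)
    ultimately show ?thesis by blast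
  qed (use f(1) in blast)
qed

text \<open>Coordinates are treated one after the other: passing to a further subsequence preserves
  the monotonicity already achieved.\<close>

lemma vector_seq_mono_subseq:
  fixes s :: "nat \<Rightarrow> nat \<Rightarrow> nat"
  shows "\<exists>r :: nat \<Rightarrow> nat. strict_mono r \<and> (\<forall>i<k. mono (\<lambda>n. s (r n) i))"
proof (induction k)
  case 0
  show ?case by (rule exI[of _ id]) (simp add: strict_mono_def)
next
  case (Suc k)
  then obtain r :: "nat \<Rightarrow> nat" where r: "strict_mono r" "\<And>i. i < k \<Longrightarrow> mono (\<lambda>n. s (r n) i)" by blast
  obtain r' :: "nat \<Rightarrow> nat" where r': "strict_mono r'" "mono ((\<lambda>n. s (r n) k) \<circ> r')"
    using nat_seq_mono_subseq by blast
  have "strict_mono (r \<circ> r')" using r r' by (simp add: strict_mono_def)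
  moreover have "mono (\<lambda>n. s ((r \<circ> r') n) i)" if "i < Suc k" for i
    using that r(2)[of i] r' strict_mono_mono[OF r'(1)]
    by (cases "i = k") (auto simp: mono_def)
  ultimately show ?case by blast
qed

text \<open>If no finite subset works, a sequence can be chosen greedily in which no vector lies
  above an earlier one. A subsequence that is monotone in the first \<open>k\<close> coordinates
  contradicts this.\<close>

lemma dickson:
  fixes V :: "(nat \<Rightarrow> nat) set"
  shows "\<exists>B. finite B \<and> B \<subseteq> V \<and> (\<forall>v\<in>V. \<exists>b\<in>B. \<forall>i<k. b i \<le> v i)"
proof (rule ccontr)
  assume no_basis: "\<not> ?thesis"
  define le where "le b v \<longleftrightarrow> (\<forall>i<k. b i \<le> v i)" for b v :: "nat \<Rightarrow> nat"
  have "\<exists>v\<in>V. \<forall>b\<in>B. \<not> le b v" if "finite B" "B \<subseteq> V" for B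
    using no_basis that unfolding le_def[symmetric] by auto
  then obtain f where f: "f B \<in> V \<and> (\<forall>b\<in>B. \<not> le b (f B))"
    if "finite B" "B \<subseteq> V" for B
    by (simp only: Bex_def) metis
  \<comment> \<open>\<open>C n\<close> collects the first \<open>n\<close> choices, so
    \<open>f (C n)\<close> is the next term of the bad sequence.\<close>
  define C where "C = rec_nat {} (\<lambda>_ B. insert (f B) B)"
  have C: "finite (C n) \<and> C n \<subseteq> V" for n
    by (induction n) (use f in \<open>auto simp: C_def\<close>)
  have in_C: "f (C m) \<in> C n" if "m < n" for m n
    using that by (induction n) (auto simp: C_def less_Suc_eq)
  obtain r :: "nat \<Rightarrow> nat" where r: "strict_mono r" "\<And>i. i < k \<Longrightarrow> mono (\<lambda>n. f (C (r n)) i)"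
    using vector_seq_mono_subseq[of k "\<lambda>n. f (C n)"] by blast
  have "r 0 < r 1" using r(1) by (simp add: strict_mono_def)
  from in_C[OF this] f[of "C (r 1)"] C[of "r 1"] have "\<not> le (f (C (r 0))) (f (C (r 1)))" by blast
  moreover have "f (C (r 0)) i \<le> f (C (r 1)) i" if "i < k" for i
    using r(2)[OF that] by (simp add: mono_def)
  ultimately show False unfolding le_def by blast
qed

section \<open>Finitely generated modules in graded commutative monoids\<close>

locale graded_monoid = comm_monoid_cancel L for L (structure) +
  fixes deg :: "'a \<Rightarrow> nat"
  assumes deg_mult: "x \<in> carrier L \<Longrightarrow> y \<in> carrier L \<Longrightarrow> deg (x \<otimes> y) = deg x + deg y"
begin

section \<open>Monomials and the submonoids that they generate\<close>

lemma deg_one [simp]: "deg \<one> = 0"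
  using deg_mult[of \<one> \<one>] by simp

lemma deg_pow: "x \<in> carrier L \<Longrightarrow> deg (x [^] k) = k * deg x" for k :: nat
  by (induction k) (simp_all add: deg_mult)

text \<open>Exponent vectors are functions on all of \<open>nat\<close>, of which only the first
  \<open>length xs\<close> values matter. Dickson's lemma applies to them directly, and the vectors
  of two lists are joined by shifting an index.\<close>

primrec monomial :: "'a list \<Rightarrow> (nat \<Rightarrow> nat) \<Rightarrow> 'a" where
  "monomial [] v = \<one>"
| "monomial (x # xs) v = x [^] v 0 \<otimes> monomial xs (\<lambda>i. v (Suc i))"

definition gen :: "'a list \<Rightarrow> 'a set" where
  "gen xs = range (monomial xs)"

lemma monomial_closed [simp]: "set xs \<subseteq> carrier L \<Longrightarrow> monomial xs v \<in> carrier L"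
  by (induction xs arbitrary: v) auto

lemma monomial_cong: "(\<And>i. i < length xs \<Longrightarrow> u i = v i) \<Longrightarrow> monomial xs u = monomial xs v"
proof (induction xs arbitrary: u v)
  case (Cons x xs)
  have "monomial xs (\<lambda>i. u (Suc i)) = monomial xs (\<lambda>i. v (Suc i))"
    using Cons.prems by (intro Cons.IH) simp
  then show ?case using Cons.prems[of 0] by simp
qed simp

lemma monomial_add:
  "set xs \<subseteq> carrier L \<Longrightarrow> monomial xs (\<lambda>i. u i + v i) = monomial xs u \<otimes> monomial xs v"
proof (induction xs arbitrary: u v)
  case (Cons x xs)
  then show ?case by (simp add: nat_pow_mult[symmetric] m_ac)
qed simp

lemma monomial_zero: "set xs \<subseteq> carrier L \<Longrightarrow> monomial xs (\<lambda>_. 0) = \<one>"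
  by (induction xs) auto

lemma monomial_append:
  "set xs \<subseteq> carrier L \<Longrightarrow> set ys \<subseteq> carrier L \<Longrightarrow>
    monomial (xs @ ys) v = monomial xs v \<otimes> monomial ys (\<lambda>i. v (i + length xs))"
  by (induction xs arbitrary: v) (simp_all add: m_assoc)

lemma monomial_in_gen: "monomial xs v \<in> gen xs"
  by (simp add: gen_def)

lemma gen_Nil [simp]: "gen [] = {\<one>}"
  by (auto simp: gen_def)

lemma gen_closed: "set xs \<subseteq> carrier L \<Longrightarrow> gen xs \<subseteq> carrier L"
  by (auto simp: gen_def)

lemma gen_one: "set xs \<subseteq> carrier L \<Longrightarrow> \<one> \<in> gen xs"
  unfolding gen_def by (rule range_eqI[of _ _ "\<lambda>_. 0"]) (simp add: monomial_zero)

lemma gen_mult: "set xs \<subseteq> carrier L \<Longrightarrow> x \<in> gen xs \<Longrightarrow> y \<in> gen xs \<Longrightarrow> x \<otimes> y \<in> gen xs"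
  unfolding gen_def by (auto simp flip: monomial_add)

lemma gen_Cons: "gen (x # xs) = {x [^] k \<otimes> m | (k :: nat) m. m \<in> gen xs}"
proof -
  have "\<exists>w. x [^] k \<otimes> monomial xs v = x [^] w 0 \<otimes> monomial xs (\<lambda>i. w (Suc i))" for k :: nat and v
    by (rule exI[of _ "case_nat k v"]) simp
  then show ?thesis by (auto simp: gen_def image_iff)
qed

lemma gen_Cons_mono: "set xs \<subseteq> carrier L \<Longrightarrow> gen xs \<subseteq> gen (x # xs)"
proof
  fix m assume "set xs \<subseteq> carrier L" "m \<in> gen xs"
  then have "m = x [^] (0 :: nat) \<otimes> m" "m \<in> gen xs" using gen_closed[of xs] by auto
  then show "m \<in> gen (x # xs)" unfolding gen_Cons by blast
qed

lemma gen_Cons_hd: "x \<in> carrier L \<Longrightarrow> set xs \<subseteq> carrier L \<Longrightarrow> x \<in> gen (x # xs)"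
proof -
  assume "x \<in> carrier L" "set xs \<subseteq> carrier L"
  then have "x = x [^] (1 :: nat) \<otimes> \<one>" "\<one> \<in> gen xs" using gen_one by auto
  then show "x \<in> gen (x # xs)" unfolding gen_Cons by blast
qed

lemma gen_elem: "set xs \<subseteq> carrier L \<Longrightarrow> x \<in> set xs \<Longrightarrow> x \<in> gen xs"
proof (induction xs)
  case (Cons y xs)
  then show ?case using gen_Cons_hd[of y xs] gen_Cons_mono[of xs y] by auto
qed simp

lemma gen_append:
  assumes "set xs \<subseteq> carrier L" "set ys \<subseteq> carrier L"
  shows "gen (xs @ ys) = gen xs <#> gen ys"
proof
  show "gen (xs @ ys) \<subseteq> gen xs <#> gen ys"
    using assms by (auto simp: gen_def set_mult_def monomial_append)
  show "gen xs <#> gen ys \<subseteq> gen (xs @ ys)"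
  proof
    fix z assume "z \<in> gen xs <#> gen ys"
    then obtain u v where z: "z = monomial xs u \<otimes> monomial ys v"
      by (auto simp: gen_def set_mult_def)
    define w where "w i = (if i < length xs then u i else v (i - length xs))" for i
    have "monomial xs w = monomial xs u" by (rule monomial_cong) (simp add: w_def)
    moreover have "(\<lambda>i. w (i + length xs)) = v" by (simp add: w_def fun_eq_iff)
    ultimately have "monomial (xs @ ys) w = z" using assms by (simp add: monomial_append z)
    then show "z \<in> gen (xs @ ys)" by (auto simp: gen_def)
  qed
qed

lemma gen_least:
  assumes "set xs \<subseteq> carrier L" "\<one> \<in> M"
    and "\<And>x m. x \<in> set xs \<Longrightarrow> m \<in> M \<Longrightarrow> x \<otimes> m \<in> M"
  shows "gen xs \<subseteq> M"
  using assms
proof (induction xs)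
  case (Cons x xs)
  have M: "gen xs \<subseteq> M" using Cons by auto
  have "x [^] k \<otimes> m \<in> M" if "m \<in> gen xs" for k :: nat and m
  proof -
    have m: "m \<in> carrier L" using that gen_closed Cons.prems by auto
    have x: "x \<in> carrier L" using Cons.prems by auto
    show ?thesis
    proof (induction k)
      case 0
      show ?case using M that m by auto
    next
      case (Suc k)
      have "x [^] Suc k \<otimes> m = x \<otimes> (x [^] k \<otimes> m)" using x m by (simp add: m_ac)
      then show ?case using Cons.prems(3)[of x] Suc by simp
    qed
  qed
  then show ?case by (auto simp: gen_Cons)
qed simp

lemma monomial_degree_positive:
  assumes "set xs \<subseteq> carrier L" "\<forall>x\<in>set xs. deg x > 0" "i < length xs" "v i \<noteq> 0"
  shows "deg (monomial xs v) > 0"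
  using assms
proof (induction xs arbitrary: v i)
  case (Cons x xs)
  show ?case
  proof (cases i)
    case 0
    then show ?thesis using Cons.prems by (simp add: deg_mult deg_pow)
  next
    case (Suc j)
    then show ?thesis using Cons.prems Cons.IH[of j "\<lambda>i. v (Suc i)"] by (simp add: deg_mult)
  qed
qed simp

text \<open>The notion of a submodule, without finite generation; the empty set qualifies and plays
  the part of the zero module.\<close>

definition stable :: "'a list \<Rightarrow> 'a set \<Rightarrow> bool" where
  "stable xs E \<longleftrightarrow> E \<subseteq> carrier L \<and> (\<forall>x\<in>set xs. \<forall>e\<in>E. x \<otimes> e \<in> E)"

lemma stable_gen:
  assumes "set xs \<subseteq> carrier L" "stable xs E" "m \<in> gen xs" "e \<in> E"
  shows "m \<otimes> e \<in> E"
proof -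
  have "gen xs \<subseteq> {m \<in> carrier L. m \<otimes> e \<in> E}"
    using assms by (intro gen_least) (auto simp: stable_def m_assoc subset_iff)
  then show ?thesis using assms by auto
qed

lemma mem_set_mult: "z \<in> A <#> B \<longleftrightarrow> (\<exists>a\<in>A. \<exists>b\<in>B. z = a \<otimes> b)"
  by (auto simp: set_mult_def)

lemma bex_set_mult: "(\<exists>z\<in>A <#> B. P z) \<longleftrightarrow> (\<exists>a\<in>A. \<exists>b\<in>B. P (a \<otimes> b))"
  unfolding set_mult_def by blast

lemma stable_module:
  assumes "set xs \<subseteq> carrier L" "F \<subseteq> carrier L"
  shows "stable xs (F <#> gen xs)"
  unfolding stable_def
proof (intro conjI ballI)
  show "F <#> gen xs \<subseteq> carrier L" using assms gen_closed by (intro set_mult_closed) auto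
  fix x e assume x: "x \<in> set xs" and "e \<in> F <#> gen xs"
  then obtain f m where e: "e = f \<otimes> m" "f \<in> F" "m \<in> gen xs" by (auto simp: mem_set_mult)
  have "x \<in> carrier L" "f \<in> carrier L" "m \<in> carrier L" using assms x e gen_closed by auto
  then have "x \<otimes> e = f \<otimes> (x \<otimes> m)" by (simp add: e m_ac)
  moreover have "x \<otimes> m \<in> gen xs" using assms x e gen_mult gen_elem by auto
  ultimately show "x \<otimes> e \<in> F <#> gen xs" using e by (auto simp: mem_set_mult)
qed

text \<open>A monomial form of Hilbert's basis theorem. For each of the finitely many
  \<open>f\<close> in \<open>F\<close>, Dickson's lemma bounds the exponent vectors that lead from
  \<open>f\<close> into \<open>E\<close> below by finitely many of them, and stability supplies
  everything above these.\<close>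

lemma submodule_finitely_generated:
  assumes xs: "set xs \<subseteq> carrier L" and F: "finite F" "F \<subseteq> carrier L"
    and E: "stable xs E" "E \<subseteq> F <#> gen xs"
  shows "\<exists>F'. finite F' \<and> F' \<subseteq> carrier L \<and> E = F' <#> gen xs"
proof -
  define V where "V f = {v. f \<otimes> monomial xs v \<in> E}" for f
  have "\<exists>B. finite B \<and> B \<subseteq> V f \<and> (\<forall>v\<in>V f. \<exists>b\<in>B. \<forall>i<length xs. b i \<le> v i)" for f
    by (rule dickson)
  then obtain B where B: "\<And>f. finite (B f)" "\<And>f. B f \<subseteq> V f"
    "\<And>f v. v \<in> V f \<Longrightarrow> \<exists>b\<in>B f. \<forall>i<length xs. b i \<le> v i"
    by metis
  define F' where "F' = (\<Union>f\<in>F. (\<lambda>b. f \<otimes> monomial xs b) ` B f)"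
  have F'E: "F' \<subseteq> E" using B(2) by (auto simp: F'_def V_def)
  have EL: "E \<subseteq> carrier L" using E by (simp add: stable_def)
  have "F' <#> gen xs \<subseteq> E"
  proof
    fix z assume "z \<in> F' <#> gen xs"
    then obtain f m where z: "z = f \<otimes> m" "f \<in> F'" "m \<in> gen xs" by (auto simp: mem_set_mult)
    then have "z = m \<otimes> f" using F'E EL gen_closed[OF xs] by (auto intro: m_comm)
    then show "z \<in> E" using stable_gen[OF xs E(1) z(3), of f] z F'E by auto
  qed
  moreover have "E \<subseteq> F' <#> gen xs"
  proof
    fix e assume "e \<in> E"
    then obtain f v where f: "f \<in> F" and e: "e = f \<otimes> monomial xs v"
      using E(2) by (auto simp: mem_set_mult gen_def subset_iff)
    then have "v \<in> V f" using \<open>e \<in> E\<close> by (simp add: V_def)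
    then obtain b where b: "b \<in> B f" "\<forall>i<length xs. b i \<le> v i" using B(3) by blast
    have "monomial xs v = monomial xs (\<lambda>i. b i + (v i - b i))"
      by (rule monomial_cong) (use b in simp)
    then have "e = (f \<otimes> monomial xs b) \<otimes> monomial xs (\<lambda>i. v i - b i)"
      using f F xs by (auto simp: e monomial_add m_assoc)
    moreover have "f \<otimes> monomial xs b \<in> F'" using f b by (auto simp: F'_def)
    ultimately show "e \<in> F' <#> gen xs" by (auto simp: mem_set_mult gen_def)
  qed
  ultimately show ?thesis
    using F B(1) F'E EL by (intro exI[of _ F']) (auto simp: F'_def)
qed

section \<open>Generating functions\<close>

definition fin_degrees :: "'a set \<Rightarrow> bool" where
  "fin_degrees D \<longleftrightarrow> (\<forall>n. finite {x \<in> D. deg x = n})"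

definition gf :: "'a set \<Rightarrow> rat fps" where
  "gf D = Abs_fps (\<lambda>n. of_nat (card {x \<in> D. deg x = n}))"

lemma gf_nth [simp]: "fps_nth (gf D) n = of_nat (card {x \<in> D. deg x = n})"
  by (simp add: gf_def)

lemma fin_degrees_subset:
  assumes "fin_degrees D" "E \<subseteq> D"
  shows "fin_degrees E"
  unfolding fin_degrees_def
proof
  fix n
  have "{x \<in> E. deg x = n} \<subseteq> {x \<in> D. deg x = n}" using assms(2) by blast
  then show "finite {x \<in> E. deg x = n}"
    by (rule finite_subset) (use assms(1) in \<open>simp add: fin_degrees_def\<close>)
qed

lemma fin_degrees_Un: "fin_degrees D \<Longrightarrow> fin_degrees E \<Longrightarrow> fin_degrees (D \<union> E)"
  by (simp add: fin_degrees_def Collect_disj_eq conj_disj_distribR)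

lemma fin_degrees_finite: "finite D \<Longrightarrow> fin_degrees D"
  by (simp add: fin_degrees_def)

lemma gf_empty [simp]: "gf {} = 0"
  by (rule fps_ext) simp

lemma gf_Un_Int:
  assumes "fin_degrees D" "fin_degrees E"
  shows "gf (D \<union> E) + gf (D \<inter> E) = gf D + gf E"
proof (rule fps_ext)
  fix n
  let ?s = "\<lambda>X. {x \<in> X. deg x = n}"
  have "card (?s D) + card (?s E) = card (?s D \<union> ?s E) + card (?s D \<inter> ?s E)"
    using assms by (intro card_Un_Int) (auto simp: fin_degrees_def)
  moreover have "?s D \<union> ?s E = ?s (D \<union> E)" "?s D \<inter> ?s E = ?s (D \<inter> E)" by auto
  ultimately show "fps_nth (gf (D \<union> E) + gf (D \<inter> E)) n = fps_nth (gf D + gf E) n"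
    by (simp flip: of_nat_add)
qed

lemma gf_disjoint_Un:
  assumes "fin_degrees D" "fin_degrees E" "D \<inter> E = {}"
  shows "gf (D \<union> E) = gf D + gf E"
  using gf_Un_Int[OF assms(1,2)] assms(3) by simp

text \<open>Cancellation makes translation injective, so no two elements of \<open>D\<close>
  collapse.\<close>

lemma gf_translate:
  assumes x: "x \<in> carrier L" and D: "D \<subseteq> carrier L"
  shows "gf ((\<otimes>) x ` D) = fps_X ^ deg x * gf D"
proof (rule fps_ext)
  fix n
  have inj: "inj_on ((\<otimes>) x) D"
    using x D l_cancel by (auto simp: inj_on_def subset_iff)
  have dm: "deg (x \<otimes> d) = deg x + deg d" if "d \<in> D" for d
    using deg_mult x D that by auto
  show "fps_nth (gf ((\<otimes>) x ` D)) n = fps_nth (fps_X ^ deg x * gf D) n"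
  proof (cases "n < deg x")
    case True
    then have "{y \<in> (\<otimes>) x ` D. deg y = n} = {}" using dm by auto
    then show ?thesis using True
      by (simp only: gf_nth card.empty) (simp add: fps_X_power_mult_nth)
  next
    case False
    then have "{y \<in> (\<otimes>) x ` D. deg y = n} = (\<otimes>) x ` {y \<in> D. deg y = n - deg x}"
      using dm by force
    moreover have "card ((\<otimes>) x ` {y \<in> D. deg y = n - deg x}) = card {y \<in> D. deg y = n - deg x}"
      by (rule card_image) (rule inj_on_subset[OF inj], auto)
    ultimately show ?thesis using False by (simp add: fps_X_power_mult_nth)
  qed
qed

lemma rational_gf_finite: "finite D \<Longrightarrow> rational_fps (gf D)"
proof -
  assume "finite D"
  define p :: "int poly" where "p = (\<Sum>x\<in>D. monom 1 (deg x))"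
  have "coeff p n = of_nat (card {x \<in> D. deg x = n})" for n
  proof -
    have "coeff p n = (\<Sum>x\<in>D. if deg x = n then 1 else 0)" by (simp add: p_def coeff_sum)
    also have "\<dots> = (\<Sum>x\<in>{x \<in> D. deg x = n}. 1)"
      using \<open>finite D\<close> by (rule sum.inter_filter[symmetric])
    finally show ?thesis by simp
  qed
  then have "gf D = rat_fps_of_poly p"
    by (intro fps_ext) (simp add: coeff_map_poly)
  then show ?thesis using rational_fps_poly by simp
qed

lemma fin_degrees_set_mult:
  assumes "A \<subseteq> carrier L" "B \<subseteq> carrier L" "fin_degrees A" "fin_degrees B"
  shows "fin_degrees (A <#> B)"
  unfolding fin_degrees_def
proof
  fix n
  let ?s = "\<lambda>X. \<Union>i\<le>n. {x \<in> X. deg x = i}"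
  have "{x \<in> A <#> B. deg x = n} \<subseteq> (\<lambda>(a, b). a \<otimes> b) ` (?s A \<times> ?s B)"
  proof
    fix z assume "z \<in> {x \<in> A <#> B. deg x = n}"
    then obtain a b where ab: "z = a \<otimes> b" "a \<in> A" "b \<in> B" "deg z = n"
      by (auto simp: mem_set_mult)
    then have "deg a + deg b = n" using deg_mult[of a b] assms(1,2) by (simp add: subset_iff)
    then have "(a, b) \<in> ?s A \<times> ?s B" using ab by auto
    then show "z \<in> (\<lambda>(a, b). a \<otimes> b) ` (?s A \<times> ?s B)" using ab(1) by force
  qed
  moreover have "finite (?s A \<times> ?s B)" using assms(3,4) by (auto simp: fin_degrees_def)
  ultimately show "finite {x \<in> A <#> B. deg x = n}" by (meson finite_imageI finite_subset)
qed

lemma fin_degrees_powers: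
  assumes "x \<in> carrier L" "deg x > 0"
  shows "fin_degrees (range (\<lambda>k :: nat. x [^] k))"
  unfolding fin_degrees_def
proof
  fix n
  have "{y \<in> range (\<lambda>k :: nat. x [^] k). deg y = n} \<subseteq> (\<lambda>k. x [^] k) ` {..n}"
  proof
    fix y assume "y \<in> {y \<in> range (\<lambda>k :: nat. x [^] k). deg y = n}"
    then obtain k :: nat where y: "y = x [^] k" and "k * deg x = n"
      using assms by (auto simp: deg_pow)
    then have "k \<le> n" using assms(2) by (cases "deg x") auto
    then show "y \<in> (\<lambda>k. x [^] k) ` {..n}" using y by blast
  qed
  then show "finite {y \<in> range (\<lambda>k :: nat. x [^] k). deg y = n}"
    by (rule finite_subset) simp
qed

lemma fin_degrees_gen:
  "set xs \<subseteq> carrier L \<Longrightarrow> \<forall>x\<in>set xs. deg x > 0 \<Longrightarrow> fin_degrees (gen xs)"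
proof (induction xs)
  case Nil
  show ?case by (simp add: fin_degrees_finite)
next
  case (Cons x xs)
  have "gen (x # xs) = range (\<lambda>k :: nat. x [^] k) <#> gen xs"
    by (auto simp: gen_Cons set_mult_def)
  moreover have "fin_degrees (range (\<lambda>k :: nat. x [^] k) <#> gen xs)"
    using Cons by (intro fin_degrees_set_mult fin_degrees_powers) (auto simp: gen_closed)
  ultimately show ?case by simp
qed

lemma fin_degrees_module:
  "set xs \<subseteq> carrier L \<Longrightarrow> \<forall>x\<in>set xs. deg x > 0 \<Longrightarrow> finite F \<Longrightarrow> F \<subseteq> carrier L \<Longrightarrow>
    fin_degrees (F <#> gen xs)"
  by (intro fin_degrees_set_mult fin_degrees_finite fin_degrees_gen gen_closed)

text \<open>The case distinction is whether the exponent of \<open>x\<close> is zero. Both cases may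
  occur for one element, which can have several representations; the lemma is applied to elements
  that are not \<open>x\<close>-multiples within the module.\<close>

lemma module_Cons_decompose:
  assumes "set (x # xs) \<subseteq> carrier L" "F \<subseteq> carrier L" "d \<in> F <#> gen (x # xs)"
  shows "d \<in> F <#> gen xs \<or> (\<exists>d'\<in>F <#> gen (x # xs). d = x \<otimes> d')"
proof -
  obtain f m and k :: nat where d: "d = f \<otimes> (x [^] k \<otimes> m)" "f \<in> F" "m \<in> gen xs"
    using assms(3) by (auto simp: mem_set_mult gen_Cons)
  have c: "x \<in> carrier L" "f \<in> carrier L" "m \<in> carrier L"
    using d assms gen_closed[of xs] by auto
  show ?thesis
  proof (cases k)
    case 0
    then show ?thesis using d c by (auto simp: mem_set_mult)
  next
    case (Suc j)
    then have "d = x \<otimes> (f \<otimes> (x [^] j \<otimes> m))" using d c by (simp add: m_ac)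
    moreover have "f \<otimes> (x [^] j \<otimes> m) \<in> F <#> gen (x # xs)"
      using d by (auto simp: mem_set_mult gen_Cons)
    ultimately show ?thesis by blast
  qed
qed

text \<open>
  The Hilbert--Serre argument: on the subquotient \<open>Q = (F <#> gen (x # xs)) - E\<close>, multiplication by
  \<open>x\<close> is a partial injection of degree \<open>deg x\<close>. Its cokernel \<open>Q - x Q\<close> and its kernel
  \<open>{d \<in> Q. x d \<in> E}\<close> are subquotients over the remaining generators \<open>xs\<close>.
\<close>

lemma rational_gf_subquotient:
  assumes "set xs \<subseteq> carrier L" "\<forall>x\<in>set xs. deg x > 0"
    and "finite F" "F \<subseteq> carrier L" "stable xs E"
  shows "rational_fps (gf ((F <#> gen xs) - E))"
  using assms
proof (induction xs arbitrary: F E)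
  case Nil
  have "F <#> gen [] = F" using Nil by (auto simp: mem_set_mult subset_iff)
  then show ?case using Nil(3) by (simp add: rational_gf_finite)
next
  case (Cons x xs)
  let ?D = "F <#> gen (x # xs)"
  let ?Q = "?D - E"
  \<comment> \<open>\<open>N\<close> is a submodule, whereas \<open>K\<close>, which is
    \<open>N\<close> without \<open>E\<close>, need not be: multiplication by a generator may lead
    from \<open>K\<close> into \<open>E\<close>. Finite generation is therefore applied to
    \<open>N\<close>.\<close>
  define N where "N = {d \<in> ?D. x \<otimes> d \<in> E}"
  define K where "K = {d \<in> ?Q. x \<otimes> d \<in> E}"
  \<comment> \<open>Enlarging \<open>E\<close> by the multiples of \<open>x\<close> writes the
    cokernel as a difference over \<open>xs\<close> alone, as the induction hypothesis
    requires.\<close>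
  define E' where "E' = E \<union> (\<otimes>) x ` ?D"
  have xs: "set xs \<subseteq> carrier L" "\<forall>x\<in>set xs. deg x > 0" and x: "x \<in> carrier L" "deg x > 0"
    using Cons.prems by auto
  have DL: "?D \<subseteq> carrier L" and EL: "E \<subseteq> carrier L"
    using stable_module[of "x # xs" F] Cons.prems by (auto simp: stable_def)
  have stabD: "y \<otimes> d \<in> ?D" if "y \<in> set (x # xs)" "d \<in> ?D" for y d
    using stable_module[of "x # xs" F] Cons.prems that unfolding stable_def by blast
  have stabE: "y \<otimes> e \<in> E" if "y \<in> set (x # xs)" "e \<in> E" for y e
    using Cons.prems(5) that unfolding stable_def by blast
  have fin: "fin_degrees ?Q"
    using fin_degrees_module[of "x # xs" F] Cons.prems by (blast intro: fin_degrees_subset)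
  have comm: "x \<otimes> (y \<otimes> d) = y \<otimes> (x \<otimes> d)" if "y \<in> set (x # xs)" "d \<in> ?D" for y d
    using that x xs DL by (auto intro!: m_lcomm)

  have "stable xs E'"
    unfolding stable_def
  proof (intro conjI ballI)
    show "E' \<subseteq> carrier L" using EL DL x by (auto simp: E'_def)
    fix y e assume y: "y \<in> set xs" and "e \<in> E'"
    then consider "e \<in> E" | d where "d \<in> ?D" "e = x \<otimes> d" by (auto simp: E'_def)
    then show "y \<otimes> e \<in> E'"
    proof cases
      case 2
      then have "y \<otimes> e = x \<otimes> (y \<otimes> d)" "y \<otimes> d \<in> ?D" using comm stabD y by auto
      then show ?thesis by (auto simp: E'_def)
    qed (use stabE y in \<open>auto simp: E'_def\<close>)
  qed
  then have coker: "rational_fps (gf ((F <#> gen xs) - E'))"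
    using Cons.IH Cons.prems xs by simp

  have "stable (x # xs) N"
    unfolding stable_def
  proof (intro conjI ballI)
    show "N \<subseteq> carrier L" using DL by (auto simp: N_def)
    fix y d assume y: "y \<in> set (x # xs)" and "d \<in> N"
    then have d: "d \<in> ?D" "x \<otimes> d \<in> E" by (auto simp: N_def)
    then show "y \<otimes> d \<in> N" using comm[OF y d(1)] stabD[OF y d(1)] stabE[OF y d(2)]
      by (simp add: N_def)
  qed
  then obtain F' where F': "finite F'" "F' \<subseteq> carrier L" "N = F' <#> gen (x # xs)"
    using submodule_finitely_generated[of "x # xs" F N] Cons.prems by (auto simp: N_def)
  have "F' <#> gen xs \<subseteq> N"
    using gen_Cons_mono[OF xs(1), of x] unfolding F'(3) set_mult_def by blast
  \<comment> \<open>Since \<open>x\<close> maps \<open>N\<close> into \<open>E\<close>, an element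
    of \<open>N\<close> outside \<open>E\<close> is no \<open>x\<close>-multiple within
    \<open>N\<close>. Hence the kernel does not involve the generator \<open>x\<close>, although
    \<open>N\<close> is generated with it.\<close>
  moreover have "d \<in> F' <#> gen xs" if "d \<in> N" "d \<notin> E" for d
  proof -
    have "d \<noteq> x \<otimes> d'" if "d' \<in> F' <#> gen (x # xs)" for d'
      using that \<open>d \<notin> E\<close> unfolding F'(3)[symmetric] N_def by auto
    then show ?thesis
      using module_Cons_decompose[of x xs F' d] that Cons.prems(1) F' by auto
  qed
  ultimately have "K = (F' <#> gen xs) - E" by (auto simp: K_def N_def)
  moreover have "stable xs E" using Cons.prems(5) by (simp add: stable_def)
  ultimately have ker: "rational_fps (gf K)" using Cons.IH xs F' by simp

  have KQ: "K \<subseteq> ?Q" by (auto simp: K_def)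
  \<comment> \<open>The elements of \<open>?Q - K\<close> are those that \<open>x\<close> keeps
    inside \<open>?Q\<close>; their images are precisely the part of \<open>?Q\<close> missed by the
    cokernel.\<close>
  have img: "?Q = ((F <#> gen xs) - E') \<union> (\<otimes>) x ` (?Q - K)"
  proof
    show "?Q \<subseteq> ((F <#> gen xs) - E') \<union> (\<otimes>) x ` (?Q - K)"
    proof
      fix d assume d: "d \<in> ?Q"
      show "d \<in> ((F <#> gen xs) - E') \<union> (\<otimes>) x ` (?Q - K)"
      proof (cases "\<exists>d'\<in>?D. d = x \<otimes> d'")
        case True
        then obtain d' where d': "d' \<in> ?D" "d = x \<otimes> d'" by blast
        then have "d' \<notin> E" "x \<otimes> d' \<notin> E" using d stabE[of x d'] by auto
        then have "d' \<in> ?Q - K" using d' by (auto simp: K_def)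
        then show ?thesis using d' by blast
      next
        case False
        then show ?thesis using d module_Cons_decompose[of x xs F d] Cons.prems
          by (auto simp: E'_def)
      qed
    qed
    have "F <#> gen xs \<subseteq> ?D" using gen_Cons_mono[OF xs(1), of x] unfolding set_mult_def by blast
    moreover have "x \<otimes> d \<in> ?Q" if "d \<in> ?Q - K" for d
      using that stabD[of x d] by (auto simp: K_def)
    ultimately show "((F <#> gen xs) - E') \<union> (\<otimes>) x ` (?Q - K) \<subseteq> ?Q"
      by (auto simp: E'_def)
  qed
  have "gf ?Q = gf ((F <#> gen xs) - E') + gf ((\<otimes>) x ` (?Q - K))"
  proof -
    have "fin_degrees ((F <#> gen xs) - E')" "fin_degrees ((\<otimes>) x ` (?Q - K))"
      using fin img by (metis fin_degrees_subset Un_upper1, metis fin_degrees_subset Un_upper2)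
    moreover have "((F <#> gen xs) - E') \<inter> (\<otimes>) x ` (?Q - K) = {}" by (auto simp: E'_def)
    ultimately show ?thesis using gf_disjoint_Un img by metis
  qed
  also have "gf ((\<otimes>) x ` (?Q - K)) = fps_X ^ deg x * gf (?Q - K)"
    using x DL by (intro gf_translate) auto
  also have "gf (?Q - K) = gf ?Q - gf K"
  proof -
    have "gf ((?Q - K) \<union> K) = gf (?Q - K) + gf K"
      using fin KQ by (intro gf_disjoint_Un) (auto intro: fin_degrees_subset)
    moreover have "(?Q - K) \<union> K = ?Q" using KQ by blast
    ultimately show ?thesis by simp
  qed
  \<comment> \<open>The alternating sum for the exact sequence of kernel, shifted \<open>?Q\<close>,
    \<open>?Q\<close> and cokernel.\<close>
  finally have "(1 - fps_X ^ deg x) * gf ?Q = gf ((F <#> gen xs) - E') - fps_X ^ deg x * gf K"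
    by (simp add: algebra_simps)
  moreover have "rational_fps \<dots>"
    by (intro rational_fps_diff rational_fps_mult rational_fps_X_power coker ker)
  ultimately show ?case using rational_fps_cancel[OF x(2)] by metis
qed

section \<open>Modules over generators of positive degree and their intersections\<close>

definition positive :: "'a list \<Rightarrow> bool" where
  "positive xs \<longleftrightarrow> set xs \<subseteq> carrier L \<and> (\<forall>x\<in>set xs. deg x > 0)"

definition fg_module :: "'a set \<Rightarrow> bool" where
  "fg_module D \<longleftrightarrow> (\<exists>F xs. finite F \<and> F \<subseteq> carrier L \<and> positive xs \<and> D = F <#> gen xs)"

lemma fg_module_fin_degrees: "fg_module D \<Longrightarrow> fin_degrees D"
  unfolding fg_module_def positive_def using fin_degrees_module by blast

lemma rational_gf_fg_module: "fg_module D \<Longrightarrow> rational_fps (gf D)"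
  unfolding fg_module_def positive_def
  using rational_gf_subquotient[where E = "{}"] by (auto simp: stable_def)

text \<open>The exponent vectors of equal monomials, with both lists side by side in one vector,
  form a monoid \<open>P\<close>. By cancellation \<open>P\<close> is also closed under subtracting
  a smaller member, so a Dickson basis of its nonzero part generates it: subtract a basis vector and
  recurse on the sum of the coordinates.\<close>

lemma gen_Int_gen:
  assumes "positive xs" "positive ys"
  shows "\<exists>zs. positive zs \<and> gen zs = gen xs \<inter> gen ys"
proof -
  let ?n = "length xs + length ys"
  let ?ys = "\<lambda>v. monomial ys (\<lambda>i. v (i + length xs))"
  define P where "P = {v. monomial xs v = ?ys v}"
  \<comment> \<open>The zero vector has to be excluded: it lies below everything, and subtracting it
    would make no progress.\<close>
  define P1 where "P1 = {v \<in> P. \<exists>i<?n. v i \<noteq> 0}"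
  have c: "set xs \<subseteq> carrier L" "set ys \<subseteq> carrier L" using assms by (auto simp: positive_def)
  obtain B where B: "finite B" "B \<subseteq> P1" "\<And>v. v \<in> P1 \<Longrightarrow> \<exists>b\<in>B. \<forall>i<?n. b i \<le> v i"
    using dickson[of P1 ?n] by auto
  obtain zs where zs: "set zs = monomial xs ` B" using B(1) by (meson finite_imageI finite_list)
  \<comment> \<open>The nonzero coordinate may belong to \<open>ys\<close>; as both monomials of
    \<open>b\<close> are the same element, its degree is positive in either case.\<close>
  have "deg (monomial xs b) > 0" if "b \<in> B" for b
  proof -
    have "b \<in> P1" using that B(2) by blast
    then obtain i where "monomial xs b = ?ys b" "i < ?n" "b i \<noteq> 0" by (auto simp: P_def P1_def)
    then show ?thesis
      using monomial_degree_positive[of xs i b]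
        monomial_degree_positive[of ys "i - length xs" "\<lambda>i. b (i + length xs)"] assms
      by (cases "i < length xs") (auto simp: positive_def)
  qed
  then have pos: "positive zs" using c by (auto simp: zs positive_def)
  have P_in: "monomial xs v \<in> gen zs" if "v \<in> P" for v
    using that
  proof (induction "\<Sum>i<?n. v i" arbitrary: v rule: less_induct)
    case less
    show ?case
    proof (cases "v \<in> P1")
      case True
      then obtain b where b: "b \<in> B" "\<And>i. i < ?n \<Longrightarrow> b i \<le> v i" using B(3) by blast
      define w where "w i = v i - b i" for i
      have split_xs: "monomial xs v = monomial xs b \<otimes> monomial xs w"
        using c b by (subst monomial_add[symmetric]) (auto intro!: monomial_cong simp: w_def)
      have split_ys: "?ys v = ?ys b \<otimes> ?ys w"
        using c b by (subst monomial_add[symmetric]) (auto intro!: monomial_cong simp: w_def)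
      have bP: "monomial xs b = ?ys b" using b(1) B(2) by (auto simp: P_def P1_def)
      have "monomial xs b \<otimes> monomial xs w = monomial xs b \<otimes> ?ys w"
        using split_xs split_ys less.prems bP by (simp add: P_def)
      then have "w \<in> P" using c l_cancel by (auto simp: P_def)
      have "b \<in> P1" using b(1) B(2) by blast
      then obtain i where i: "i < ?n" "b i \<noteq> 0" by (auto simp: P1_def)
      have "(\<Sum>i<?n. w i) < (\<Sum>i<?n. v i)"
        by (rule sum_strict_mono_ex1) (use i b(2)[OF i(1)] in \<open>auto simp: w_def intro!: bexI[of _ i]\<close>)
      then have "monomial xs w \<in> gen zs" using less.hyps \<open>w \<in> P\<close> by blast
      moreover have "monomial xs b \<in> gen zs"
        using b(1) zs pos by (intro gen_elem) (auto simp: positive_def)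
      ultimately show ?thesis using split_xs gen_mult pos by (simp add: positive_def)
    next
      case False
      then have "v i = 0" if "i < ?n" for i using less.prems that by (auto simp: P1_def)
      then have "monomial xs v = monomial xs (\<lambda>_. 0)" by (intro monomial_cong) simp
      then show ?thesis using monomial_zero c gen_one pos by (simp add: positive_def)
    qed
  qed
  have "gen xs \<inter> gen ys \<subseteq> gen zs"
  proof
    fix z assume "z \<in> gen xs \<inter> gen ys"
    then obtain u v where uv: "z = monomial xs u" "z = monomial ys v"
      unfolding gen_def by blast
    define w where "w i = (if i < length xs then u i else v (i - length xs))" for i
    have "monomial xs w = monomial xs u" by (rule monomial_cong) (simp add: w_def)
    moreover have "(\<lambda>i. w (i + length xs)) = v" by (simp add: w_def fun_eq_iff)
    ultimately have "w \<in> P" "z = monomial xs w" using uv by (auto simp: P_def)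
    then show "z \<in> gen zs" using P_in by blast
  qed
  moreover have "gen zs \<subseteq> gen xs \<inter> gen ys"
  proof (rule gen_least)
    show "set zs \<subseteq> carrier L" using pos by (simp add: positive_def)
    show "\<one> \<in> gen xs \<inter> gen ys" using c gen_one by simp
    fix x m assume x: "x \<in> set zs" and m: "m \<in> gen xs \<inter> gen ys"
    from x obtain b where b: "b \<in> B" "x = monomial xs b" by (auto simp: zs)
    then have "x = ?ys b" using B(2) by (auto simp: P_def P1_def)
    then have "x \<in> gen ys" by (simp only: monomial_in_gen)
    moreover have "x \<in> gen xs" unfolding b(2) by (rule monomial_in_gen)
    ultimately have "x \<in> gen xs \<inter> gen ys" by blast
    then show "x \<otimes> m \<in> gen xs \<inter> gen ys" using m c gen_mult by auto
  qed
  ultimately show ?thesis using pos by blast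
qed

text \<open>The inhomogeneous companion of \<open>gen_Int_gen\<close>: subtracting a solution of
  \<open>c x^u = c' y^v\<close> from a larger one leaves, by cancellation, a solution of
  \<open>x^w = y^w\<close>. Finitely many solutions below all others thus give the
  translates.\<close>

lemma coset_Int_coset:
  assumes xs: "set xs \<subseteq> carrier L" and ys: "set ys \<subseteq> carrier L" and c: "c \<in> carrier L" "c' \<in> carrier L"
  shows "\<exists>F. finite F \<and> F \<subseteq> carrier L \<and>
           ({c} <#> gen xs) \<inter> ({c'} <#> gen ys) = F <#> (gen xs \<inter> gen ys)"
proof -
  let ?n = "length xs + length ys"
  let ?ys = "\<lambda>v. monomial ys (\<lambda>i. v (i + length xs))"
  define P where "P = {v. c \<otimes> monomial xs v = c' \<otimes> ?ys v}"
  obtain B where B: "finite B" "B \<subseteq> P" "\<And>v. v \<in> P \<Longrightarrow> \<exists>b\<in>B. \<forall>i<?n. b i \<le> v i"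
    using dickson[of P ?n] by auto
  define F where "F = (\<lambda>b. c \<otimes> monomial xs b) ` B"
  have "({c} <#> gen xs) \<inter> ({c'} <#> gen ys) \<subseteq> F <#> (gen xs \<inter> gen ys)"
  proof
    fix z assume "z \<in> ({c} <#> gen xs) \<inter> ({c'} <#> gen ys)"
    then have "\<exists>u. z = c \<otimes> monomial xs u" "\<exists>u'. z = c' \<otimes> monomial ys u'"
      by (simp_all add: mem_set_mult gen_def)
    then obtain u u' where u: "z = c \<otimes> monomial xs u" "z = c' \<otimes> monomial ys u'" by blast
    define v where "v i = (if i < length xs then u i else u' (i - length xs))" for i
    have "monomial xs v = monomial xs u" by (rule monomial_cong) (simp add: v_def)
    moreover have "(\<lambda>i. v (i + length xs)) = u'" by (simp add: v_def fun_eq_iff)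
    ultimately have v: "v \<in> P" "z = c \<otimes> monomial xs v" using u by (auto simp: P_def)
    then obtain b where b: "b \<in> B" "\<And>i. i < ?n \<Longrightarrow> b i \<le> v i" using B(3) by blast
    define w where "w i = v i - b i" for i
    have split_xs: "monomial xs v = monomial xs b \<otimes> monomial xs w"
      using xs b by (subst monomial_add[symmetric]) (auto intro!: monomial_cong simp: w_def)
    have split_ys: "?ys v = ?ys b \<otimes> ?ys w"
      using ys b by (subst monomial_add[symmetric]) (auto intro!: monomial_cong simp: w_def)
    have bP: "c \<otimes> monomial xs b = c' \<otimes> ?ys b" using b(1) B(2) by (auto simp: P_def)
    have z: "z = (c \<otimes> monomial xs b) \<otimes> monomial xs w"
      using v split_xs c xs by (simp add: m_assoc)
    have "(c \<otimes> monomial xs b) \<otimes> monomial xs w = (c \<otimes> monomial xs b) \<otimes> ?ys w"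
    proof -
      have "(c \<otimes> monomial xs b) \<otimes> monomial xs w = c' \<otimes> ?ys v"
        using z v by (simp add: P_def)
      also have "\<dots> = (c' \<otimes> ?ys b) \<otimes> ?ys w" using split_ys c ys by (simp add: m_assoc)
      finally show ?thesis using bP by simp
    qed
    then have "monomial xs w = ?ys w" using l_cancel c xs ys by auto
    then have "monomial xs w \<in> gen xs \<inter> gen ys" by (metis IntI monomial_in_gen)
    then show "z \<in> F <#> (gen xs \<inter> gen ys)" using z b(1) by (auto simp: mem_set_mult F_def)
  qed
  moreover have "F <#> (gen xs \<inter> gen ys) \<subseteq> ({c} <#> gen xs) \<inter> ({c'} <#> gen ys)"
  proof
    fix z assume "z \<in> F <#> (gen xs \<inter> gen ys)"
    then obtain b m where b: "b \<in> B" and m: "m \<in> gen xs" "m \<in> gen ys"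
      and z: "z = (c \<otimes> monomial xs b) \<otimes> m" by (auto simp: mem_set_mult F_def)
    have "m \<in> carrier L" using m xs gen_closed by auto
    then have "z = c \<otimes> (monomial xs b \<otimes> m)" using z c xs by (simp add: m_assoc)
    moreover have "z = c' \<otimes> (?ys b \<otimes> m)"
    proof -
      have "c \<otimes> monomial xs b = c' \<otimes> ?ys b" using b B(2) by (auto simp: P_def)
      then show ?thesis using z c ys \<open>m \<in> carrier L\<close> by (simp add: m_assoc)
    qed
    moreover have "monomial xs b \<otimes> m \<in> gen xs" "?ys b \<otimes> m \<in> gen ys"
      using gen_mult m xs ys by (auto simp: gen_def)
    ultimately show "z \<in> ({c} <#> gen xs) \<inter> ({c'} <#> gen ys)"
      unfolding mem_set_mult Int_iff by blast
  qed
  moreover have "finite F" "F \<subseteq> carrier L" using B c xs by (auto simp: F_def)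
  ultimately show ?thesis by blast
qed

lemma set_mult_UN_left: "(\<Union>i\<in>I. A i) <#> B = (\<Union>i\<in>I. A i <#> B)"
  unfolding set_mult_def by blast

lemma set_mult_UN_right: "A <#> (\<Union>i\<in>I. B i) = (\<Union>i\<in>I. A <#> B i)"
  unfolding set_mult_def by blast

text \<open>The generators \<open>zs\<close> depend on \<open>xs\<close> and \<open>ys\<close> but
  not on the translates, so the intersections of the single translates combine into one
  module.\<close>

lemma fg_module_Int:
  assumes "fg_module D" "fg_module E"
  shows "fg_module (D \<inter> E)"
proof -
  obtain F xs F' ys where D: "finite F" "F \<subseteq> carrier L" "positive xs" "D = F <#> gen xs"
    and E: "finite F'" "F' \<subseteq> carrier L" "positive ys" "E = F' <#> gen ys"
    using assms unfolding fg_module_def by blast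
  obtain zs where zs: "positive zs" "gen zs = gen xs \<inter> gen ys"
    using gen_Int_gen D E by blast
  have "\<forall>p\<in>F \<times> F'. \<exists>H. finite H \<and> H \<subseteq> carrier L \<and>
      ({fst p} <#> gen xs) \<inter> ({snd p} <#> gen ys) = H <#> gen zs"
    unfolding zs(2) using D E by (intro ballI coset_Int_coset) (auto simp: positive_def)
  then obtain H where H: "\<forall>p\<in>F \<times> F'. finite (H p) \<and> H p \<subseteq> carrier L \<and>
      ({fst p} <#> gen xs) \<inter> ({snd p} <#> gen ys) = H p <#> gen zs"
    by (rule bchoice[THEN exE])
  have "D \<inter> E = (\<Union>p\<in>F \<times> F'. ({fst p} <#> gen xs) \<inter> ({snd p} <#> gen ys))"
  proof -
    have "D = (\<Union>f\<in>F. {f} <#> gen xs)" "E = (\<Union>f\<in>F'. {f} <#> gen ys)"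
      unfolding D E set_mult_def by auto
    then show ?thesis by fastforce
  qed
  also have "\<dots> = (\<Union>p\<in>F \<times> F'. H p <#> gen zs)" by (intro SUP_cong refl) (use H in blast)
  also have "\<dots> = (\<Union>p\<in>F \<times> F'. H p) <#> gen zs" by (simp only: set_mult_UN_left)
  finally have "D \<inter> E = (\<Union>p\<in>F \<times> F'. H p) <#> gen zs" .
  moreover have "finite (\<Union>p\<in>F \<times> F'. H p)" "(\<Union>p\<in>F \<times> F'. H p) \<subseteq> carrier L"
    using H D E by auto
  ultimately show ?thesis using zs(1) unfolding fg_module_def by blast
qed

lemma fin_degrees_Union: "finite Ds \<Longrightarrow> \<forall>D\<in>Ds. fin_degrees D \<Longrightarrow> fin_degrees (\<Union>Ds)"
  by (induction Ds rule: finite_induct) (auto intro: fin_degrees_Un fin_degrees_finite)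

text \<open>Inclusion--exclusion, in which the intersections are again finitely generated modules.\<close>

lemma rational_gf_Union_list:
  "\<forall>D\<in>set Ds. fg_module D \<Longrightarrow> rational_fps (gf (\<Union>(set Ds)))"
\<comment> \<open>Induction on the length, since the hypothesis is applied both to \<open>Es\<close>
  and to the list of its intersections with \<open>D\<close>.\<close>
proof (induction "length Ds" arbitrary: Ds)
  case (Suc n)
  then obtain D Es where Ds: "Ds = D # Es" "length Es = n" by (cases Ds) auto
  let ?U = "\<Union>(set Es)"
  have "rational_fps (gf (\<Union>(set (map ((\<inter>) D) Es))))"
    using Suc.prems fg_module_Int Ds by (intro Suc.hyps) auto
  moreover have "\<Union>(set (map ((\<inter>) D) Es)) = D \<inter> ?U" by auto
  ultimately have "rational_fps (gf (D \<inter> ?U))" by simp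
  moreover have "rational_fps (gf D)" "rational_fps (gf ?U)"
    using Suc Ds rational_gf_fg_module by auto
  moreover have "gf (D \<union> ?U) = gf D + gf ?U - gf (D \<inter> ?U)"
  proof -
    have "fin_degrees D" "fin_degrees ?U"
      using Suc.prems Ds fg_module_fin_degrees by (auto intro!: fin_degrees_Union)
    then show ?thesis using gf_Un_Int by (simp add: eq_diff_eq)
  qed
  ultimately show ?case using Ds by (simp add: rational_fps_add rational_fps_diff)
qed simp

section \<open>Semilinear sets\<close>

text \<open>Unlike in \<open>fg_module\<close>, each translate has its own list of periods.\<close>

definition semilinear :: "'a set \<Rightarrow> bool" where
  "semilinear X \<longleftrightarrow> (\<exists>I. finite I \<and> (\<forall>(c, xs)\<in>I. c \<in> carrier L \<and> positive xs) \<and>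
     X = (\<Union>(c, xs)\<in>I. {c} <#> gen xs))"

lemma semilinear_Union_modules:
  assumes "semilinear X"
  shows "\<exists>Ds. finite Ds \<and> (\<forall>D\<in>Ds. fg_module D) \<and> X = \<Union>Ds"
proof -
  obtain I where I: "finite I" "\<forall>(c, xs)\<in>I. c \<in> carrier L \<and> positive xs"
    "X = (\<Union>(c, xs)\<in>I. {c} <#> gen xs)"
    using assms unfolding semilinear_def by blast
  have "fg_module ({c} <#> gen xs)" if "(c, xs) \<in> I" for c xs
    unfolding fg_module_def using that I(2) by (intro exI[of _ "{c}"] exI[of _ xs]) auto
  then show ?thesis
    using I by (intro exI[of _ "(\<lambda>(c, xs). {c} <#> gen xs) ` I"]) auto
qed

lemma rational_gf_semilinear: "semilinear X \<Longrightarrow> rational_fps (gf X)"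
  using semilinear_Union_modules rational_gf_Union_list by (metis finite_list)

lemma semilinear_fin_degrees: "semilinear X \<Longrightarrow> fin_degrees X"
  using semilinear_Union_modules fin_degrees_Union fg_module_fin_degrees by metis

lemma semilinear_linear: "c \<in> carrier L \<Longrightarrow> positive xs \<Longrightarrow> semilinear ({c} <#> gen xs)"
  unfolding semilinear_def by (intro exI[of _ "{(c, xs)}"]) simp

lemma semilinear_gen:
  assumes "positive xs"
  shows "semilinear (gen xs)"
proof -
  have "gen xs \<subseteq> carrier L" using assms gen_closed by (simp add: positive_def)
  then have "{\<one>} <#> gen xs = gen xs" by (auto simp: mem_set_mult subset_iff)
  then show ?thesis using semilinear_linear[OF one_closed assms] by simp
qed

lemma semilinear_empty: "semilinear {}"
  unfolding semilinear_def by (intro exI[of _ "{}"]) simp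

lemma semilinear_Un:
  assumes "semilinear X" "semilinear Y"
  shows "semilinear (X \<union> Y)"
proof -
  obtain I J where "finite I" "\<forall>(c, xs)\<in>I. c \<in> carrier L \<and> positive xs"
    "X = (\<Union>(c, xs)\<in>I. {c} <#> gen xs)"
    "finite J" "\<forall>(c, xs)\<in>J. c \<in> carrier L \<and> positive xs"
    "Y = (\<Union>(c, xs)\<in>J. {c} <#> gen xs)"
    using assms unfolding semilinear_def by blast
  then show ?thesis unfolding semilinear_def by (intro exI[of _ "I \<union> J"]) auto
qed

lemma semilinear_UN: "finite I \<Longrightarrow> (\<And>i. i \<in> I \<Longrightarrow> semilinear (X i)) \<Longrightarrow> semilinear (\<Union>i\<in>I. X i)"
  by (induction I rule: finite_induct) (auto intro: semilinear_empty semilinear_Un)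

lemma semilinear_finite: "finite X \<Longrightarrow> X \<subseteq> carrier L \<Longrightarrow> semilinear X"
proof -
  assume X: "finite X" "X \<subseteq> carrier L"
  have "semilinear {x}" if "x \<in> X" for x
    using semilinear_linear[of x "[]"] that X by (auto simp: positive_def set_mult_def)
  then show ?thesis using semilinear_UN[OF X(1), of "\<lambda>x. {x}"] by simp
qed

lemma semilinear_closed: "semilinear X \<Longrightarrow> X \<subseteq> carrier L"
  unfolding semilinear_def positive_def using gen_closed by (fastforce simp: mem_set_mult)

lemma semilinear_induct [consumes 1, case_names empty Un]:
  assumes "semilinear X" "P {}"
    and Un: "\<And>c xs Y. c \<in> carrier L \<Longrightarrow> positive xs \<Longrightarrow> semilinear Y \<Longrightarrow> P Y \<Longrightarrow>
      P (({c} <#> gen xs) \<union> Y)"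
  shows "P X"
proof -
  obtain I where I: "finite I" "\<forall>(c, xs)\<in>I. c \<in> carrier L \<and> positive xs"
    and X: "X = (\<Union>(c, xs)\<in>I. {c} <#> gen xs)"
    using assms(1) unfolding semilinear_def by blast
  have "semilinear (\<Union>(c, xs)\<in>I. {c} <#> gen xs) \<and> P (\<Union>(c, xs)\<in>I. {c} <#> gen xs)"
    using I
  proof (induction I rule: finite_induct)
    case (insert p I)
    then show ?case by (cases p) (auto intro!: Un semilinear_Un semilinear_linear)
  qed (use assms(2) semilinear_empty in auto)
  then show ?thesis using X by simp
qed

lemma semilinear_set_mult:
  assumes "semilinear X" "semilinear Y"
  shows "semilinear (X <#> Y)"
proof -
  obtain I J where I: "finite I" "\<forall>(c, xs)\<in>I. c \<in> carrier L \<and> positive xs"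
    "X = (\<Union>(c, xs)\<in>I. {c} <#> gen xs)"
    and J: "finite J" "\<forall>(c, xs)\<in>J. c \<in> carrier L \<and> positive xs"
    "Y = (\<Union>(c, xs)\<in>J. {c} <#> gen xs)"
    using assms unfolding semilinear_def by blast
  have lin: "({c} <#> gen xs) <#> ({d} <#> gen ys) = {c \<otimes> d} <#> gen (xs @ ys)"
    if "c \<in> carrier L" "d \<in> carrier L" "positive xs" "positive ys" for c d xs ys
  proof -
    have cl: "set xs \<subseteq> carrier L" "set ys \<subseteq> carrier L" using that by (auto simp: positive_def)
    have "(c \<otimes> m) \<otimes> (d \<otimes> m') = (c \<otimes> d) \<otimes> (m \<otimes> m')" if "m \<in> gen xs" "m' \<in> gen ys" for m m'
      using that gen_closed cl \<open>c \<in> carrier L\<close> \<open>d \<in> carrier L\<close> by (simp add: m_ac subset_iff)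
    then show ?thesis
      by (simp add: set_eq_iff gen_append[OF cl] mem_set_mult bex_set_mult cong: bex_cong)
  qed
  have "X <#> Y = (\<Union>p\<in>I. \<Union>q\<in>J. ({fst p} <#> gen (snd p)) <#> ({fst q} <#> gen (snd q)))"
    unfolding I J by (simp add: set_mult_UN_left set_mult_UN_right split_beta) blast
  moreover have "semilinear (({fst p} <#> gen (snd p)) <#> ({fst q} <#> gen (snd q)))"
    if "p \<in> I" "q \<in> J" for p q
  proof -
    have "fst p \<in> carrier L" "fst q \<in> carrier L" "positive (snd p)" "positive (snd q)"
      using that I(2) J(2) by auto
    moreover from this have "positive (snd p @ snd q)" by (auto simp: positive_def)
    ultimately show ?thesis using lin semilinear_linear by simp
  qed
  ultimately show ?thesis using I(1) J(1) by (auto intro!: semilinear_UN)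
qed

section \<open>The star operation in a commutative monoid\<close>

inductive_set star :: "'a set \<Rightarrow> 'a set" for X where
  star_one: "\<one> \<in> star X"
| star_step: "x \<in> X \<Longrightarrow> y \<in> star X \<Longrightarrow> x \<otimes> y \<in> star X"

lemma star_closed:
  assumes "X \<subseteq> carrier L"
  shows "star X \<subseteq> carrier L"
proof
  fix y assume "y \<in> star X"
  then show "y \<in> carrier L" by induction (use assms in auto)
qed

lemma star_mono:
  assumes "X \<subseteq> Y"
  shows "star X \<subseteq> star Y"
proof
  fix y assume "y \<in> star X"
  then show "y \<in> star Y" by induction (use assms in \<open>auto intro: star.intros\<close>)
qed

lemma star_mult:
  assumes "X \<subseteq> carrier L" "y \<in> star X" "z \<in> star X"
  shows "y \<otimes> z \<in> star X"
  using assms(2)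
proof induction
  case star_one
  then show ?case using assms(3) star_closed[OF assms(1)] by (auto simp: subset_iff)
next
  case (star_step x y)
  have "x \<in> carrier L" "y \<in> carrier L" "z \<in> carrier L"
    using star_step assms star_closed by auto
  then have "(x \<otimes> y) \<otimes> z = x \<otimes> (y \<otimes> z)" by (rule m_assoc)
  then show ?case using star.star_step[OF star_step(1) star_step(3)] by simp
qed

lemma subset_star: "X \<subseteq> carrier L \<Longrightarrow> X \<subseteq> star X"
  using star_step[of _ X \<one>] star_one by (auto simp: subset_iff)

text \<open>Commutativity allows the factors from \<open>X\<close> to be sorted in front of those
  from \<open>Y\<close>.\<close>

lemma star_Un:
  assumes "X \<subseteq> carrier L" "Y \<subseteq> carrier L"
  shows "star (X \<union> Y) = star X <#> star Y"
proof
  note c = star_closed[OF assms(1)] star_closed[OF assms(2)]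
  show "star (X \<union> Y) \<subseteq> star X <#> star Y"
  proof
    fix z assume "z \<in> star (X \<union> Y)"
    then show "z \<in> star X <#> star Y"
    proof induction
      case star_one
      have "\<one> = \<one> \<otimes> \<one>" by simp
      then show ?case using star.star_one unfolding mem_set_mult by blast
    next
      case (star_step x z)
      then obtain a b where z: "z = a \<otimes> b" "a \<in> star X" "b \<in> star Y"
        unfolding mem_set_mult by blast
      then have ab: "a \<in> carrier L" "b \<in> carrier L" using c by auto
      have x: "x \<in> carrier L" using star_step(1) assms by auto
      show ?case
      proof (cases "x \<in> X")
        case True
        have "x \<otimes> z = (x \<otimes> a) \<otimes> b" using x ab by (simp add: z m_assoc)
        then show ?thesis using star.star_step[OF True z(2)] z(3) unfolding mem_set_mult by blast
      next
        case False
        then have "x \<in> Y" using star_step(1) by blast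
        moreover have "x \<otimes> z = a \<otimes> (x \<otimes> b)" using x ab by (simp add: z m_lcomm)
        ultimately show ?thesis
          using star.star_step[OF _ z(3), of x] z(2) unfolding mem_set_mult by blast
      qed
    qed
  qed
  show "star X <#> star Y \<subseteq> star (X \<union> Y)"
  proof
    fix z assume "z \<in> star X <#> star Y"
    then obtain a b where z: "z = a \<otimes> b" "a \<in> star X" "b \<in> star Y"
      unfolding mem_set_mult by blast
    then have "a \<in> star (X \<union> Y)" "b \<in> star (X \<union> Y)"
      using star_mono[of X "X \<union> Y"] star_mono[of Y "X \<union> Y"] by auto
    then show "z \<in> star (X \<union> Y)" using z(1) star_mult[of "X \<union> Y"] assms by simp
  qed
qed

text \<open>In a product of \<open>k + 1\<close> elements the offsets contribute
  \<open>k + 1\<close> factors \<open>c\<close> and the periods merge into a single element of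
  \<open>gen xs\<close>. One factor \<open>c\<close> stays in front because the periods become
  available only with the first element; the empty product is separate.\<close>

lemma star_linear:
  assumes c: "c \<in> carrier L" and xs: "set xs \<subseteq> carrier L"
  shows "star ({c} <#> gen xs) = {\<one>} \<union> ({c} <#> gen (c # xs))"
proof
  have cxs: "set (c # xs) \<subseteq> carrier L" using assms by simp
  have cX: "{c} <#> gen xs \<subseteq> carrier L" using c gen_closed[OF xs] by (intro set_mult_closed) auto
  show "star ({c} <#> gen xs) \<subseteq> {\<one>} \<union> ({c} <#> gen (c # xs))"
  proof
    fix z assume "z \<in> star ({c} <#> gen xs)"
    then show "z \<in> {\<one>} \<union> ({c} <#> gen (c # xs))"
    proof induction
      case (star_step x y)
      then obtain m where m: "m \<in> gen xs" "x = c \<otimes> m" by (auto simp: mem_set_mult)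
      have m': "m \<in> gen (c # xs)" using m gen_Cons_mono[OF xs] by auto
      have mc: "m \<in> carrier L" using m gen_closed xs by auto
      from star_step(3) consider "y = \<one>" | m2 where "m2 \<in> gen (c # xs)" "y = c \<otimes> m2"
        by (auto simp: mem_set_mult)
      then have "\<exists>m3\<in>gen (c # xs). x \<otimes> y = c \<otimes> m3"
      proof cases
        case 1
        then show ?thesis using m m' mc c by (intro bexI[of _ m]) auto
      next
        case 2
        then have "m2 \<in> carrier L" using gen_closed[OF cxs] by auto
        then have "x \<otimes> y = c \<otimes> (c \<otimes> (m \<otimes> m2))" using 2 m mc c by (simp add: m_ac)
        moreover have "c \<otimes> (m \<otimes> m2) \<in> gen (c # xs)"
          using 2 m' gen_mult[OF cxs] gen_Cons_hd[OF c xs] by blast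
        ultimately show ?thesis by blast
      qed
      then show ?case by (simp add: mem_set_mult)
    qed simp
  qed
  have "c \<otimes> (c [^] k \<otimes> m) \<in> star ({c} <#> gen xs)" if "m \<in> gen xs" for k :: nat and m
  proof (induction k)
    case 0
    have "c \<otimes> m \<in> {c} <#> gen xs" "m \<in> carrier L"
      using that gen_closed[OF xs] by (auto simp: mem_set_mult)
    then show ?case using subset_star[OF cX] by auto
  next
    case (Suc k)
    have "m \<in> carrier L" using that gen_closed[OF xs] by auto
    then have "c \<otimes> (c [^] Suc k \<otimes> m) = c \<otimes> (c \<otimes> (c [^] k \<otimes> m))"
      using c by (simp add: m_ac)
    moreover have "c \<in> {c} <#> gen xs"
      using c gen_one[OF xs] by (auto simp: mem_set_mult intro!: bexI[of _ \<one>])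
    ultimately show ?case using star_step Suc by simp
  qed
  then show "{\<one>} \<union> ({c} <#> gen (c # xs)) \<subseteq> star ({c} <#> gen xs)"
    by (auto simp: mem_set_mult gen_Cons star_one)
qed

text \<open>Taking the star turns the offset of a linear set into a period, which is why the
  elements of \<open>X\<close> must have positive degree.\<close>

lemma semilinear_star:
  assumes "semilinear X" "\<forall>x\<in>X. deg x > 0"
  shows "semilinear (star X)"
  using assms
proof (induction rule: semilinear_induct)
  case empty
  have "star {} = {\<one>}" by (auto intro: star_one elim: star.cases)
  then show ?case by (simp add: semilinear_finite)
next
  case (Un c xs Y)
  have xs: "set xs \<subseteq> carrier L" using Un(2) by (simp add: positive_def)
  have "c \<in> {c} <#> gen xs"
    using Un(1) gen_one[OF xs] by (auto simp: mem_set_mult intro!: bexI[of _ \<one>])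
  then have "deg c > 0" using Un.prems by blast
  then have "positive (c # xs)" using Un(1,2) by (simp add: positive_def)
  then have "semilinear ({\<one>} \<union> ({c} <#> gen (c # xs)))"
    using Un(1) by (intro semilinear_Un semilinear_linear semilinear_finite) auto
  then have "semilinear (star ({c} <#> gen xs))" using star_linear[OF Un(1) xs] by simp
  moreover have "semilinear (star Y)" using Un by blast
  moreover have "star (({c} <#> gen xs) \<union> Y) = star ({c} <#> gen xs) <#> star Y"
    using Un(1,3) gen_closed[OF xs] semilinear_closed by (intro star_Un set_mult_closed) auto
  ultimately show ?case using semilinear_set_mult by simp
qed

section \<open>Kleene's algorithm\<close>

text \<open>\<open>K\<close> restricts the intermediate vertices only, not the endpoints. Walks are
  nonempty, so their labels inherit positive degree from the edges.\<close>

inductive walk :: "('q \<times> 'a \<times> 'q) set \<Rightarrow> 'q set \<Rightarrow> 'q \<Rightarrow> 'a \<Rightarrow> 'q \<Rightarrow> bool"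
  for Ed K where
  edge: "(p, x, q) \<in> Ed \<Longrightarrow> walk Ed K p x q"
| join: "walk Ed K p x r \<Longrightarrow> r \<in> K \<Longrightarrow> walk Ed K r y q \<Longrightarrow> walk Ed K p (x \<otimes> y) q"

lemma walk_mono: "walk Ed K p x q \<Longrightarrow> K \<subseteq> K' \<Longrightarrow> walk Ed K' p x q"
  by (induction rule: walk.induct) (auto intro: walk.intros)

lemma walk_carrier:
  assumes "\<forall>(p, x, q)\<in>Ed. x \<in> carrier L \<and> deg x > 0" "walk Ed K p x q"
  shows "x \<in> carrier L \<and> deg x > 0"
  using assms(2) by (induction rule: walk.induct) (use assms(1) in \<open>auto simp: deg_mult\<close>)

text \<open>A walk through \<open>k\<close> is cut at its visits to \<open>k\<close>: the part
  before the first visit, a product of loops, and the part after the last. The induction on joins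
  maintains this shape \<open>a \<otimes> (s \<otimes> b)\<close>.\<close>

lemma walk_insert:
  assumes Ed: "\<forall>(p, x, q)\<in>Ed. x \<in> carrier L \<and> deg x > 0"
  defines "W \<equiv> \<lambda>K p q. {x. walk Ed K p x q}"
  shows "W (insert k K) p q = W K p q \<union> (W K p k <#> (star (W K k k) <#> W K k q))"
proof
  have WL: "W K p q \<subseteq> carrier L" for K p q
    using walk_carrier[OF Ed] by (auto simp: W_def)
  let ?S = "star (W K k k)"
  have SL: "?S \<subseteq> carrier L" using WL by (rule star_closed)
  have join_W: "x \<otimes> y \<in> W K p q" if "x \<in> W K p r" "r \<in> K" "y \<in> W K r q" for x y p r q
    using that walk.join by (auto simp: W_def)
  show "W (insert k K) p q \<subseteq> W K p q \<union> (W K p k <#> (?S <#> W K k q))"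
  proof
    fix x assume "x \<in> W (insert k K) p q"
    then have "walk Ed (insert k K) p x q" by (simp add: W_def)
    then have "x \<in> W K p q \<or> (\<exists>a\<in>W K p k. \<exists>s\<in>?S. \<exists>b\<in>W K k q. x = a \<otimes> (s \<otimes> b))"
    proof (induction rule: walk.induct)
      case (edge p x q)
      then show ?case using walk.edge by (auto simp: W_def)
    next
      case (join p x r y q)
      \<comment> \<open>When both halves visit \<open>k\<close> and meet elsewhere, the end
        \<open>b1\<close> of the first and the start \<open>a2\<close> of the second merge into a
        loop at \<open>k\<close>.\<close>
      have through: "\<exists>a\<in>W K p k. \<exists>s\<in>?S. \<exists>b\<in>W K k q. (a1 \<otimes> (s1 \<otimes> b1)) \<otimes> (a2 \<otimes> (s2 \<otimes> b2)) = a \<otimes> (s \<otimes> b)"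
        if "a1 \<in> W K p k" "s1 \<in> ?S" "b2 \<in> W K k q" "s2 \<in> ?S" "b1 \<otimes> a2 \<in> ?S"
          "b1 \<in> carrier L" "a2 \<in> carrier L" for a1 s1 b1 a2 s2 b2
      proof -
        have c: "a1 \<in> carrier L" "s1 \<in> carrier L" "b2 \<in> carrier L" "s2 \<in> carrier L"
          using that WL SL by auto
        have "s1 \<otimes> ((b1 \<otimes> a2) \<otimes> s2) \<in> ?S"
          using star_mult[OF WL] that by blast
        moreover have "(a1 \<otimes> (s1 \<otimes> b1)) \<otimes> (a2 \<otimes> (s2 \<otimes> b2))
            = a1 \<otimes> ((s1 \<otimes> ((b1 \<otimes> a2) \<otimes> s2)) \<otimes> b2)"
          using c that by (simp add: m_assoc)
        ultimately show ?thesis using that by blast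
      qed
      \<comment> \<open>When the halves meet at \<open>k\<close> itself, the final piece of the
        first half is already a loop and is absorbed into the star; \<open>out\<close> treats the
        second half in the same way.\<close>
      have into: "\<exists>a\<in>W K p k. \<exists>s\<in>?S. x = a \<otimes> s" if "r = k"
      proof -
        from join.IH(1) that consider "x \<in> W K p k"
          | a s b where "a \<in> W K p k" "s \<in> ?S" "b \<in> W K k k" "x = a \<otimes> (s \<otimes> b)" by blast
        then show ?thesis
        proof cases
          case 1
          then have "x \<in> carrier L" using WL by blast
          then have "x = x \<otimes> \<one>" by simp
          then show ?thesis using 1 star_one by blast
        next
          case 2
          then have "s \<otimes> b \<in> ?S" using star_mult[OF WL] subset_star[OF WL] by blast
          then show ?thesis using 2 by blast
        qed
      qed
      have out: "\<exists>s\<in>?S. \<exists>b\<in>W K k q. y = s \<otimes> b" if "r = k"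
      proof -
        from join.IH(2) that consider "y \<in> W K k q"
          | a s b where "a \<in> W K k k" "s \<in> ?S" "b \<in> W K k q" "y = a \<otimes> (s \<otimes> b)" by blast
        then show ?thesis
        proof cases
          case 1
          then have "y \<in> carrier L" using WL by blast
          then have "y = \<one> \<otimes> y" by simp
          then show ?thesis using 1 star_one by blast
        next
          case 2
          then have "a \<in> carrier L" "s \<in> carrier L" "b \<in> carrier L" using WL SL by auto
          then have "y = (a \<otimes> s) \<otimes> b" using 2 by (simp add: m_assoc)
          moreover have "a \<otimes> s \<in> ?S" using 2 star_step by blast
          ultimately show ?thesis using 2 by blast
        qed
      qed
      show ?case
      proof (cases "r = k")
        case True
        obtain a s1 s2 b where *: "a \<in> W K p k" "s1 \<in> ?S" "x = a \<otimes> s1"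
          "s2 \<in> ?S" "b \<in> W K k q" "y = s2 \<otimes> b"
          using into[OF True] out[OF True] by blast
        have "a \<in> carrier L" "s1 \<in> carrier L" "s2 \<in> carrier L" "b \<in> carrier L"
          using * WL SL by auto
        then have "x \<otimes> y = a \<otimes> ((s1 \<otimes> s2) \<otimes> b)" using * by (simp add: m_assoc)
        moreover have "s1 \<otimes> s2 \<in> ?S" using star_mult[OF WL] * by blast
        ultimately show ?thesis using * by blast
      next
        case False
        then have r: "r \<in> K" using join by simp
        from join.IH(1) consider "x \<in> W K p r"
          | a s b where "a \<in> W K p k" "s \<in> ?S" "b \<in> W K k r" "x = a \<otimes> (s \<otimes> b)" by blast
        note x_cases = this
        from join.IH(2) consider "y \<in> W K r q"
          | a s b where "a \<in> W K r k" "s \<in> ?S" "b \<in> W K k q" "y = a \<otimes> (s \<otimes> b)" by blast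
        then show ?thesis
        proof cases
          case y: 1
          from x_cases show ?thesis
          proof cases
            case 1
            then show ?thesis using y join_W r by blast
          next
            case 2
            then have "a \<in> carrier L" "s \<in> carrier L" "b \<in> carrier L" "y \<in> carrier L"
              using WL SL y by auto
            then have "x \<otimes> y = a \<otimes> (s \<otimes> (b \<otimes> y))" using 2 by (simp add: m_assoc)
            moreover have "b \<otimes> y \<in> W K k q" using join_W 2 y r by blast
            ultimately show ?thesis using 2 by blast
          qed
        next
          case y: 2
          then have c: "a \<in> carrier L" "s \<in> carrier L" "b \<in> carrier L" using WL SL by auto
          from x_cases show ?thesis
          proof cases
            case 1
            then have "x \<in> carrier L" using WL by auto
            then have "x \<otimes> y = (x \<otimes> a) \<otimes> (s \<otimes> b)" using y c by (simp add: m_assoc)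
            moreover have "x \<otimes> a \<in> W K p k" using join_W 1 y r by blast
            ultimately show ?thesis using y by blast
          next
            case (2 a1 s1 b1)
            have "b1 \<otimes> a \<in> W K k k" using join_W 2 y r by blast
            then have "b1 \<otimes> a \<in> ?S" using subset_star[OF WL] by blast
            moreover have "b1 \<in> carrier L" using 2 WL by auto
            ultimately show ?thesis using through[of a1 s1 b s b1 a] 2 y c by blast
          qed
        qed
      qed
    qed
    then show "x \<in> W K p q \<union> (W K p k <#> (?S <#> W K k q))"
      by (auto simp: mem_set_mult bex_set_mult)
  qed
  show "W K p q \<union> (W K p k <#> (?S <#> W K k q)) \<subseteq> W (insert k K) p q"
  proof -
    have mono: "W K p q \<subseteq> W (insert k K) p q" for p q
      using walk_mono[of Ed K _ _ _ "insert k K"] by (auto simp: W_def)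
    have loops: "s \<otimes> b \<in> W (insert k K) k q" if "s \<in> ?S" "b \<in> W K k q" for s b
      using that(1)
    proof induction
      case star_one
      then show ?case using that(2) WL mono by (auto simp: subset_iff)
    next
      case (star_step x s)
      have "x \<in> carrier L" "s \<in> carrier L" "b \<in> carrier L" using star_step that WL SL by auto
      then have "(x \<otimes> s) \<otimes> b = x \<otimes> (s \<otimes> b)" by (rule m_assoc)
      moreover have "x \<in> W (insert k K) k k" using mono star_step by blast
      ultimately show ?case using star_step walk.join[of Ed "insert k K" k x k]
        by (simp add: W_def)
    qed
    have "a \<otimes> (s \<otimes> b) \<in> W (insert k K) p q" if "a \<in> W K p k" "s \<in> ?S" "b \<in> W K k q" for a s b
      using loops[OF that(2,3)] subsetD[OF mono that(1)] walk.join[of Ed "insert k K" p a k]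
      by (auto simp: W_def)
    then show ?thesis using mono by (auto simp: mem_set_mult bex_set_mult)
  qed
qed

text \<open>With no intermediate vertex allowed a walk is a single edge, and each further vertex
  costs one product with a star of loops, whose labels have positive degree.\<close>

lemma semilinear_walks:
  assumes "finite Ed" and Ed: "\<forall>(p, x, q)\<in>Ed. x \<in> carrier L \<and> deg x > 0" and "finite K"
  shows "semilinear {x. walk Ed K p x q}"
  using assms(3)
proof (induction K arbitrary: p q rule: finite_induct)
  case empty
  have "walk Ed {} p x q \<Longrightarrow> (p, x, q) \<in> Ed" for x by (cases rule: walk.cases) auto
  then have "{x. walk Ed {} p x q} \<subseteq> (fst \<circ> snd) ` Ed" by force
  then have "finite {x. walk Ed {} p x q}" using assms(1) by (meson finite_imageI finite_subset)
  then show ?case using walk_carrier[OF Ed] by (intro semilinear_finite) auto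
next
  case (insert k K)
  have "\<forall>x\<in>{x. walk Ed K k x k}. deg x > 0" using walk_carrier[OF Ed] by blast
  then show ?case unfolding walk_insert[OF Ed]
    by (intro semilinear_Un semilinear_set_mult semilinear_star insert.IH)
qed

end

section \<open>Weights of cosets\<close>

lemma Inf_nat_le_iff:
  fixes X :: "nat set"
  assumes "X \<noteq> {}"
  shows "Inf X \<le> n \<longleftrightarrow> (\<exists>x\<in>X. x \<le> n)"
  using Inf_nat_def1[OF assms] wellorder_Inf_le1 by (meson order_trans)

lemma word_eval_Cons: "word_eval G (s # w) = s \<otimes>\<^bsub>G\<^esub> word_eval G w"
  by (simp add: word_eval_def)

lemma word_weight_Cons: "word_weight \<omega> (s # w) = \<omega> s + word_weight \<omega> w"
  by (simp add: word_weight_def)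

lemma word_weight_append: "word_weight \<omega> (u @ w) = word_weight \<omega> u + word_weight \<omega> w"
  by (simp add: word_weight_def)

lemma (in monoid) word_eval_closed:
  "S \<subseteq> carrier G \<Longrightarrow> w \<in> lists S \<Longrightarrow> word_eval G w \<in> carrier G"
  by (induction w) (auto simp: word_eval_def)

lemma (in monoid) word_eval_append:
  assumes "S \<subseteq> carrier G" "u \<in> lists S" "w \<in> lists S"
  shows "word_eval G (u @ w) = word_eval G u \<otimes> word_eval G w"
  using assms(2)
proof (induction u)
  case Nil
  then show ?case using word_eval_closed[OF assms(1,3)] by (simp add: word_eval_def)
next
  case (Cons s u)
  then have "s \<in> carrier G" "word_eval G u \<in> carrier G"
    using assms word_eval_closed by auto
  then show ?case
    using Cons word_eval_closed[OF assms(1,3)] by (simp add: word_eval_Cons m_assoc)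
qed

text \<open>Comparison with a bound merges the two nested minima into one existential statement
  about words. Generation makes the sets nonempty, so that \<open>Inf\<close> is attained.\<close>

lemma coset_weight_le_iff:
  assumes S: "finite_generating_set G S" and C: "C \<noteq> {}" "C \<subseteq> carrier G"
  shows "coset_weight G S \<omega> C \<le> n \<longleftrightarrow>
    (\<exists>w\<in>lists S. word_eval G w \<in> C \<and> word_weight \<omega> w \<le> n)"
proof -
  have elt: "elt_weight G S \<omega> g \<le> n \<longleftrightarrow> (\<exists>w\<in>lists S. word_eval G w = g \<and> word_weight \<omega> w \<le> n)"
    if "g \<in> C" for g
  proof -
    have "{word_weight \<omega> w | w. w \<in> lists S \<and> word_eval G w = g} \<noteq> {}"
      using S C that unfolding finite_generating_set_def by blast
    then show ?thesis unfolding elt_weight_def by (subst Inf_nat_le_iff) auto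
  qed
  have "coset_weight G S \<omega> C \<le> n \<longleftrightarrow> (\<exists>g\<in>C. elt_weight G S \<omega> g \<le> n)"
    unfolding coset_weight_def by (subst Inf_nat_le_iff) (use C in auto)
  then show ?thesis using elt by auto
qed

section \<open>The translation into a finite graph\<close>

lemma (in group) rcos_eq_iff:
  assumes "subgroup H G" "x \<in> carrier G" "y \<in> carrier G"
  shows "H #> x = H #> y \<longleftrightarrow> x \<otimes> inv y \<in> H"
proof -
  have "H \<subseteq> carrier G" using assms(1) by (rule subgroup.subset)
  then have "H #> x = H #> y \<longleftrightarrow> H #> (x \<otimes> inv y) = H"
    using coset_mult_inv1 coset_mult_inv2 assms by metis
  also have "\<dots> \<longleftrightarrow> x \<otimes> inv y \<in> H"
    using coset_join1 coset_join2 assms by (metis \<open>H \<subseteq> carrier G\<close> inv_closed m_closed)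
  finally show ?thesis .
qed

definition nat_graded :: "('a, 'b) monoid_scheme \<Rightarrow> ('a \<times> nat) monoid" where
  "nat_graded Q = \<lparr>carrier = carrier Q \<times> UNIV,
     monoid.mult = (\<lambda>x y. (fst x \<otimes>\<^bsub>Q\<^esub> fst y, snd x + snd y)), one = (\<one>\<^bsub>Q\<^esub>, 0)\<rparr>"

lemma nat_graded_simps [simp]:
  "carrier (nat_graded Q) = carrier Q \<times> UNIV"
  "x \<otimes>\<^bsub>nat_graded Q\<^esub> y = (fst x \<otimes>\<^bsub>Q\<^esub> fst y, snd x + snd y)"
  "\<one>\<^bsub>nat_graded Q\<^esub> = (\<one>\<^bsub>Q\<^esub>, 0)"
  by (simp_all add: nat_graded_def)

lemma graded_monoid_nat_graded:
  assumes "comm_group Q"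
  shows "graded_monoid (nat_graded Q) snd"
proof -
  interpret Q: comm_group Q by fact
  have "comm_monoid (nat_graded Q)"
    by (rule comm_monoidI) (auto simp: Q.m_ac)
  then have "comm_monoid_cancel (nat_graded Q)"
    by (rule comm_monoid_cancelI) (auto simp: prod_eq_iff)
  then show ?thesis by (simp add: graded_monoid_def graded_monoid_axioms_def)
qed

section \<open>Factorization along the left cosets of the abelian subgroup\<close>

locale transversal = group G for G (structure) +
  fixes A R :: "'a set"
  assumes A: "subgroup A G"
    and A_comm: "comm_group (G\<lparr>carrier := A\<rparr>)"
    and R_finite: "finite R" and R_subset: "R \<subseteq> carrier G" and one_in_R: "\<one> \<in> R"
    and factorization: "g \<in> carrier G \<Longrightarrow> \<exists>r\<in>R. \<exists>a\<in>A. g = r \<otimes> a"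
begin

text \<open>\<open>R\<close> may meet a left coset of \<open>A\<close> several times, so a
  factorization has to be chosen; \<open>part\<close> is chosen relative to this choice.\<close>

definition rep :: "'a \<Rightarrow> 'a" where
  "rep g = (SOME r. r \<in> R \<and> (\<exists>a\<in>A. g = r \<otimes> a))"

definition part :: "'a \<Rightarrow> 'a" where
  "part g = (SOME a. a \<in> A \<and> g = rep g \<otimes> a)"

lemma rep_part:
  assumes "g \<in> carrier G"
  shows "rep g \<in> R" "part g \<in> A" "g = rep g \<otimes> part g"
proof -
  have "\<exists>r. r \<in> R \<and> (\<exists>a\<in>A. g = r \<otimes> a)" using factorization[OF assms] by blast
  from someI_ex[OF this] have rep: "rep g \<in> R \<and> (\<exists>a\<in>A. g = rep g \<otimes> a)"
    unfolding rep_def .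
  then have "\<exists>a. a \<in> A \<and> g = rep g \<otimes> a" by blast
  from someI_ex[OF this] have "part g \<in> A \<and> g = rep g \<otimes> part g" unfolding part_def .
  then show "rep g \<in> R" "part g \<in> A" "g = rep g \<otimes> part g" using rep by auto
qed

lemma A_closed: "a \<in> A \<Longrightarrow> a \<in> carrier G"
  using subgroup.subset[OF A] by auto

lemma R_closed: "r \<in> R \<Longrightarrow> r \<in> carrier G"
  using R_subset by auto

end

section \<open>The right cosets of \<open>H\<close> inside one double coset
  \<open>H t A\<close>\<close>

locale double_coset = transversal +
  fixes H :: "'a set" and t :: 'a
  assumes H: "subgroup H G" and t: "t \<in> carrier G"
begin

sublocale A: comm_group "G\<lparr>carrier := A\<rparr>"
  by (rule A_comm)

text \<open>\<open>A\<close> acts by right translation on the right cosets of \<open>H\<close> in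
  \<open>H t A\<close>, transitively; this is the stabilizer of the coset
  \<open>H t\<close>.\<close>

definition stabilizer :: "'a set" where
  "stabilizer = {b \<in> A. t \<otimes> b \<otimes> inv t \<in> H}"

lemma stabilizer_subgroup: "subgroup stabilizer (G\<lparr>carrier := A\<rparr>)"
proof (rule A.subgroupI)
  have "\<one> \<in> stabilizer"
    using subgroup.one_closed[OF A] subgroup.one_closed[OF H] t by (simp add: stabilizer_def)
  then show "stabilizer \<noteq> {}" by blast
  show "stabilizer \<subseteq> carrier (G\<lparr>carrier := A\<rparr>)" by (auto simp: stabilizer_def)
next
  fix b assume "b \<in> stabilizer"
  then have b: "b \<in> A" "t \<otimes> b \<otimes> inv t \<in> H" "b \<in> carrier G"
    using A_closed by (auto simp: stabilizer_def)
  have "t \<otimes> inv b \<otimes> inv t = inv (t \<otimes> b \<otimes> inv t)"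
    using b t by (simp add: inv_mult_group m_assoc)
  then have "inv b \<in> stabilizer"
    using b subgroup.m_inv_closed[OF H b(2)] subgroup.m_inv_closed[OF A b(1)]
    by (simp add: stabilizer_def)
  then show "inv\<^bsub>G\<lparr>carrier := A\<rparr>\<^esub> b \<in> stabilizer"
    using b(1) A by (simp add: m_inv_consistent)
next
  fix b c assume "b \<in> stabilizer" "c \<in> stabilizer"
  then have b: "b \<in> A" "t \<otimes> b \<otimes> inv t \<in> H" "b \<in> carrier G"
    and c: "c \<in> A" "t \<otimes> c \<otimes> inv t \<in> H" "c \<in> carrier G"
    using A_closed by (auto simp: stabilizer_def)
  have "t \<otimes> (b \<otimes> c) \<otimes> inv t = (t \<otimes> b \<otimes> inv t) \<otimes> (t \<otimes> c \<otimes> inv t)"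
    using b c t by (simp add: m_assoc inv_solve_left' flip: m_assoc[of "inv t" t])
  then have "t \<otimes> (b \<otimes> c) \<otimes> inv t \<in> H" using subgroup.m_closed[OF H b(2) c(2)] by simp
  then show "b \<otimes>\<^bsub>G\<lparr>carrier := A\<rparr>\<^esub> c \<in> stabilizer"
    using subgroup.m_closed[OF A b(1) c(1)] by (simp add: stabilizer_def)
qed

definition cls :: "'a \<Rightarrow> 'a set" where
  "cls a = stabilizer #>\<^bsub>G\<lparr>carrier := A\<rparr>\<^esub> a"

definition quotient :: "'a set monoid" where
  "quotient = G\<lparr>carrier := A\<rparr> Mod stabilizer"

abbreviation L :: "('a set \<times> nat) monoid" where
  "L \<equiv> nat_graded quotient"

sublocale L: graded_monoid L snd
  unfolding quotient_def
  by (intro graded_monoid_nat_graded A.abelian_FactGroup stabilizer_subgroup)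

abbreviation right_coset :: "'a \<Rightarrow> 'a set" where
  "right_coset a \<equiv> H #> (t \<otimes> a)"

lemma carrier_quotient: "carrier quotient = cls ` A"
  by (auto simp: quotient_def FactGroup_def RCOSETS_def cls_def)

lemma cls_mult: "a \<in> A \<Longrightarrow> b \<in> A \<Longrightarrow> cls a \<otimes>\<^bsub>quotient\<^esub> cls b = cls (a \<otimes> b)"
  using normal.rcos_sum[OF A.subgroup_imp_normal[OF stabilizer_subgroup], of a b]
  by (simp add: cls_def quotient_def FactGroup_def)

lemma cls_one: "\<one>\<^bsub>quotient\<^esub> = cls \<one>"
  using A.coset_join2[OF _ stabilizer_subgroup, of \<one>] subgroup.one_closed[OF A]
    subgroup.one_closed[OF stabilizer_subgroup]
  by (simp add: cls_def quotient_def FactGroup_def)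

text \<open>Orbit and stabilizer: both sides say that \<open>t (a b^-1) t^-1\<close> lies in
  \<open>H\<close>. This identifies \<open>quotient\<close> with the set of right cosets in
  \<open>H t A\<close>.\<close>

lemma cls_eq_iff:
  assumes "a \<in> A" "b \<in> A"
  shows "cls a = cls b \<longleftrightarrow> right_coset a = right_coset b"
proof -
  have c: "a \<in> carrier G" "b \<in> carrier G" "a \<otimes> inv b \<in> A"
    using assms A_closed subgroup.m_closed[OF A] subgroup.m_inv_closed[OF A] by auto
  have "cls a = cls b \<longleftrightarrow> a \<otimes> inv b \<in> stabilizer"
    unfolding cls_def using A.rcos_eq_iff[OF stabilizer_subgroup, of a b] assms A
    by (simp add: m_inv_consistent)
  also have "\<dots> \<longleftrightarrow> t \<otimes> (a \<otimes> inv b) \<otimes> inv t \<in> H" using c by (simp add: stabilizer_def)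
  also have "t \<otimes> (a \<otimes> inv b) \<otimes> inv t = (t \<otimes> a) \<otimes> inv (t \<otimes> b)"
    using c t by (simp add: inv_mult_group m_assoc)
  also have "\<dots> \<in> H \<longleftrightarrow> right_coset a = right_coset b"
    using rcos_eq_iff[OF H] c t by simp
  finally show ?thesis .
qed

lemma right_coset_translate:
  assumes "g \<in> right_coset b" "b \<in> A" "v \<in> A"
  shows "g \<otimes> v \<in> right_coset (b \<otimes> v)"
proof -
  obtain h where h: "h \<in> H" "g = h \<otimes> (t \<otimes> b)" using assms(1) by (auto simp: r_coset_def)
  have "h \<in> carrier G" using h subgroup.subset[OF H] by auto
  then have "g \<otimes> v = h \<otimes> (t \<otimes> (b \<otimes> v))" using h t assms A_closed by (simp add: m_assoc)
  then show ?thesis using h by (auto simp: r_coset_def)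
qed

lemma right_coset_eqI:
  assumes "g \<in> right_coset a" "g \<in> right_coset b" "a \<in> A" "b \<in> A"
  shows "right_coset a = right_coset b"
proof -
  have "t \<otimes> a \<in> carrier G" "t \<otimes> b \<in> carrier G" using assms t A_closed by auto
  then show ?thesis
    using repr_independence[OF assms(1) _ H] repr_independence[OF assms(2) _ H] by simp
qed

lemma right_coset_closed: "a \<in> A \<Longrightarrow> right_coset a \<subseteq> carrier G"
  using t A_closed by (intro r_coset_subset_G subgroup.subset[OF H]) auto

lemma right_coset_nonempty: "a \<in> A \<Longrightarrow> right_coset a \<noteq> {}"
  using rcos_self[OF _ H, of "t \<otimes> a"] t A_closed by auto

end

text \<open>Meant for classes in \<open>quotient\<close> and right cosets, both indexed by elements
  of \<open>A\<close>: \<open>inv_into\<close> picks an index, and the equal kernels make the choice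
  immaterial.\<close>

lemma bij_betw_images:
  assumes "\<And>x y. x \<in> X \<Longrightarrow> y \<in> X \<Longrightarrow> f x = f y \<longleftrightarrow> g x = g y"
  shows "bij_betw (\<lambda>z. g (inv_into X f z)) (f ` X) (g ` X)"
proof -
  have inv: "inv_into X f (f x) \<in> X" "f (inv_into X f (f x)) = f x" if "x \<in> X" for x
    using that by (auto intro: inv_into_into f_inv_into_f)
  have g: "g (inv_into X f (f x)) = g x" if "x \<in> X" for x
    using inv[OF that] assms[OF inv(1)[OF that] that] by simp
  have "inj_on (\<lambda>z. g (inv_into X f z)) (f ` X)"
    using g assms by (auto simp: inj_on_def)
  moreover have "(\<lambda>z. g (inv_into X f z)) ` (f ` X) = g ` X"
    using g by (simp add: image_image cong: image_cong)
  ultimately show ?thesis by (simp add: bij_betw_def)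
qed

section \<open>Words as walks, and the weights in one double coset\<close>

locale weighted_double_coset = double_coset +
  fixes S :: "'a set" and \<omega> :: "'a \<Rightarrow> nat"
  assumes S: "finite_generating_set G S" and \<omega>: "\<And>s. s \<in> S \<Longrightarrow> \<omega> s > 0"
begin

lemma S_finite: "finite S" and S_closed: "S \<subseteq> carrier G"
  using S by (auto simp: finite_generating_set_def)

text \<open>
  Words act from the left and are read from right to left, so the \<open>A\<close>-part is collected on the
  right and no conjugation occurs; \<open>A\<close> need not be normal.
\<close>

definition edges :: "('a \<times> ('a set \<times> nat) \<times> 'a) set" where
  "edges = (\<lambda>(r, s). (r, (cls (part (s \<otimes> r)), \<omega> s), rep (s \<otimes> r))) ` (R \<times> S)"

lemma edges_valid: "\<forall>(p, x, q)\<in>edges. x \<in> carrier L \<and> snd x > 0"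
  using S_closed R_closed rep_part(2) \<omega> by (auto simp: edges_def carrier_quotient subset_iff)

lemma edges_finite: "finite edges"
  using S_finite R_finite by (simp add: edges_def)

text \<open>Prepending a letter to the word appends an edge to the walk: \<open>s q v\<close> is
  \<open>rep (s q)\<close> times \<open>part (s q) v\<close>. The \<open>A\<close>-parts thus
  accumulate in the order opposite to the labels, which commutativity of \<open>A\<close>
  reconciles.\<close>

lemma walk_of_word:
  assumes "p \<in> R" "w \<in> lists S" "w \<noteq> []"
  shows "\<exists>q\<in>R. \<exists>v\<in>A. L.walk edges R p (cls v, word_weight \<omega> w) q \<and>
    word_eval G w \<otimes> p = q \<otimes> v"
  using assms(2,3)
proof (induction w)
  case (Cons s w)
  then have s: "s \<in> S" "s \<in> carrier G" and w: "w \<in> lists S" using S_closed by auto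
  have step: "L.walk edges R q (cls (part (s \<otimes> q)), \<omega> s) (rep (s \<otimes> q))" if "q \<in> R" for q
    using that s by (intro L.walk.edge) (auto simp: edges_def)
  have rp: "rep (s \<otimes> q) \<in> R" "part (s \<otimes> q) \<in> A" "s \<otimes> q = rep (s \<otimes> q) \<otimes> part (s \<otimes> q)"
    if "q \<in> R" for q
    using rep_part[of "s \<otimes> q"] s R_closed[OF that] by auto
  show ?case
  proof (cases "w = []")
    case True
    then have "word_eval G (s # w) \<otimes> p = s \<otimes> p" "word_weight \<omega> (s # w) = \<omega> s"
      using s by (simp_all add: word_eval_def word_weight_def)
    then show ?thesis using step rp assms(1) by metis
  next
    case False
    then obtain q v where q: "q \<in> R" and v: "v \<in> A"
      and walk: "L.walk edges R p (cls v, word_weight \<omega> w) q"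
      and eq: "word_eval G w \<otimes> p = q \<otimes> v"
      using Cons by auto
    let ?q = "rep (s \<otimes> q)" and ?b = "part (s \<otimes> q)"
    have c: "word_eval G w \<in> carrier G" "p \<in> carrier G" "q \<in> carrier G" "v \<in> carrier G"
      "?q \<in> carrier G" "?b \<in> carrier G"
      using word_eval_closed[OF S_closed w] R_closed A_closed assms(1) q v rp[OF q] by auto
    have "L.walk edges R p ((cls v, word_weight \<omega> w) \<otimes>\<^bsub>L\<^esub> (cls ?b, \<omega> s)) ?q"
      by (rule L.walk.join[OF walk q step[OF q]])
    also have "(cls v, word_weight \<omega> w) \<otimes>\<^bsub>L\<^esub> (cls ?b, \<omega> s)
        = (cls (?b \<otimes> v), word_weight \<omega> (s # w))"
      using v rp(2)[OF q] A.m_comm[of v ?b] by (simp add: cls_mult word_weight_Cons)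
    finally have "L.walk edges R p (cls (?b \<otimes> v), word_weight \<omega> (s # w)) ?q" .
    moreover have "word_eval G (s # w) \<otimes> p = ?q \<otimes> (?b \<otimes> v)"
    proof -
      have "word_eval G (s # w) \<otimes> p = s \<otimes> (q \<otimes> v)"
        using s c eq by (simp add: word_eval_Cons m_assoc)
      also have "\<dots> = (s \<otimes> q) \<otimes> v" using s c by (simp add: m_assoc)
      also have "\<dots> = (?q \<otimes> ?b) \<otimes> v" using rp(3)[OF q] by simp
      finally show ?thesis using c by (simp add: m_assoc)
    qed
    moreover have "?b \<otimes> v \<in> A" using subgroup.m_closed[OF A] rp(2)[OF q] v by blast
    ultimately show ?thesis using rp(1)[OF q] by blast
  qed
qed simp

text \<open>The later half of a walk acts further to the left, so a join corresponds to the
  concatenation \<open>u' @ u\<close> in reverse order.\<close>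

lemma word_of_walk:
  assumes "L.walk edges R p x q"
  shows "p \<in> R \<and> q \<in> R \<and> (\<exists>w\<in>lists S. \<exists>v\<in>A. x = (cls v, word_weight \<omega> w) \<and>
    word_eval G w \<otimes> p = q \<otimes> v)"
  using assms
proof (induction rule: L.walk.induct)
  case (edge p x q)
  then obtain s where s: "p \<in> R" "s \<in> S" and x: "x = (cls (part (s \<otimes> p)), \<omega> s)"
    and q: "q = rep (s \<otimes> p)" by (auto simp: edges_def)
  have c: "s \<in> carrier G" "p \<in> carrier G" using s S_closed R_closed by auto
  have "word_eval G [s] \<otimes> p = q \<otimes> part (s \<otimes> p)"
    using c rep_part(3)[of "s \<otimes> p"] by (simp add: word_eval_def q)
  moreover have "x = (cls (part (s \<otimes> p)), word_weight \<omega> [s])" by (simp add: x word_weight_def)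
  moreover have "[s] \<in> lists S" "q \<in> R" "part (s \<otimes> p) \<in> A" using s c rep_part q by auto
  ultimately show ?case using s by blast
next
  case (join p x r y q)
  obtain u v where u: "u \<in> lists S" "v \<in> A" "x = (cls v, word_weight \<omega> u)"
    "word_eval G u \<otimes> p = r \<otimes> v" using join.IH(1) by blast
  obtain u' v' where u': "u' \<in> lists S" "v' \<in> A" "y = (cls v', word_weight \<omega> u')"
    "word_eval G u' \<otimes> r = q \<otimes> v'" using join.IH(2) by blast
  have c: "word_eval G u \<in> carrier G" "word_eval G u' \<in> carrier G" "p \<in> carrier G" "q \<in> carrier G"
    "r \<in> carrier G" "v \<in> carrier G" "v' \<in> carrier G"
    using word_eval_closed[OF S_closed] u u' R_closed A_closed join by auto
  have "word_eval G (u' @ u) \<otimes> p = word_eval G u' \<otimes> (r \<otimes> v)"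
    using word_eval_append[OF S_closed u'(1) u(1)] u(4) c by (simp add: m_assoc)
  also have "\<dots> = (q \<otimes> v') \<otimes> v" using c u'(4) by (simp flip: m_assoc)
  also have "\<dots> = q \<otimes> (v' \<otimes> v)" using c by (simp add: m_assoc)
  finally have "word_eval G (u' @ u) \<otimes> p = q \<otimes> (v' \<otimes> v)" .
  moreover have "x \<otimes>\<^bsub>L\<^esub> y = (cls (v' \<otimes> v), word_weight \<omega> (u' @ u))"
    using u u' A.m_comm[of v v'] by (simp add: cls_mult word_weight_append)
  moreover have "v' \<otimes> v \<in> A" using subgroup.m_closed[OF A] u u' by blast
  moreover have "u' @ u \<in> lists S" using u u' by auto
  ultimately show ?case using join.IH by blast
qed

text \<open>Walks are nonempty, so the empty word contributes its label separately, at the starting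
  vertex.\<close>

definition reached :: "'a \<Rightarrow> ('a set \<times> nat) set" where
  "reached q = (if q = \<one> then {\<one>\<^bsub>L\<^esub>} else {}) \<union> {x. L.walk edges R \<one> x q}"

lemma semilinear_reached: "L.semilinear (reached q)"
proof -
  have "L.semilinear (if q = \<one> then {\<one>\<^bsub>L\<^esub>} else {})"
    by (rule L.semilinear_finite) (use L.one_closed in auto)
  then show ?thesis
    unfolding reached_def by (rule L.semilinear_Un[OF _ L.semilinear_walks[OF edges_finite edges_valid R_finite]])
qed

lemma reached_of_word:
  assumes "w \<in> lists S"
  shows "\<exists>q\<in>R. \<exists>v\<in>A. (cls v, word_weight \<omega> w) \<in> reached q \<and> word_eval G w = q \<otimes> v"
proof (cases "w = []")
  case True
  then have "(cls \<one>, word_weight \<omega> w) \<in> reached \<one>" "word_eval G w = \<one> \<otimes> \<one>"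
    by (simp_all add: reached_def word_weight_def word_eval_def cls_one)
  then show ?thesis using one_in_R subgroup.one_closed[OF A] by blast
next
  case False
  then obtain q v where "q \<in> R" "v \<in> A" "L.walk edges R \<one> (cls v, word_weight \<omega> w) q"
    "word_eval G w \<otimes> \<one> = q \<otimes> v"
    using walk_of_word[OF one_in_R assms] by blast
  moreover from this have "(cls v, word_weight \<omega> w) \<in> reached q" by (simp add: reached_def)
  moreover have "word_eval G w \<otimes> \<one> = word_eval G w"
    using word_eval_closed[OF S_closed assms] by simp
  ultimately show ?thesis by metis
qed

lemma word_of_reached:
  assumes "x \<in> reached q"
  shows "\<exists>w\<in>lists S. \<exists>v\<in>A. x = (cls v, word_weight \<omega> w) \<and> word_eval G w = q \<otimes> v"
proof (cases "L.walk edges R \<one> x q")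
  case True
  then obtain w v where w: "w \<in> lists S" "v \<in> A" "x = (cls v, word_weight \<omega> w)"
    "word_eval G w \<otimes> \<one> = q \<otimes> v" using word_of_walk by blast
  then have "word_eval G w = q \<otimes> v" using word_eval_closed[OF S_closed w(1)] by simp
  then show ?thesis using w by blast
next
  case False
  then have "q = \<one>" "x = (cls \<one>, word_weight \<omega> [])"
    using assms by (auto simp: reached_def cls_one word_weight_def split: if_splits)
  moreover have "word_eval G [] = \<one> \<otimes> \<one>" by (simp add: word_eval_def)
  ultimately show ?thesis using subgroup.one_closed[OF A] by blast
qed

text \<open>The epigraph of the coset weight on \<open>H t A\<close>, with cosets encoded by their
  classes.\<close>

definition weight_region :: "('a set \<times> nat) set" where
  "weight_region = {(cls a, n) | a n. a \<in> A \<and>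
     (\<exists>w\<in>lists S. word_eval G w \<in> right_coset a \<and> word_weight \<omega> w \<le> n)}"

lemma one_in_A: "\<one> \<in> A"
  by (rule subgroup.one_closed[OF A])

lemma positive_degree_one: "L.positive [(cls \<one>, 1)]"
  using one_in_A unfolding L.positive_def by (simp add: carrier_quotient)

text \<open>Multiplication by this monoid raises the weight and fixes the class; it is what closes
  the labels of words upwards into an epigraph.\<close>

lemma gen_degree_one: "L.gen [(cls \<one>, 1)] = {(cls \<one>, k) | k. True}"
proof -
  have pow: "(cls \<one>, 1) [^]\<^bsub>L\<^esub> (k :: nat) = (cls \<one>, k)" for k
  proof (induction k)
    case 0
    show ?case by (simp add: cls_one)
  next
    case (Suc k)
    then show ?case using one_in_A cls_mult[of \<one> \<one>] by simp
  qed
  have "(cls \<one>, k) \<otimes>\<^bsub>L\<^esub> \<one>\<^bsub>L\<^esub> = (cls \<one>, k)" for k :: nat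
    using one_in_A cls_mult[of \<one> \<one>] by (simp add: cls_one)
  then show ?thesis unfolding L.gen_Cons L.gen_Nil pow by auto
qed

text \<open>For a word with value \<open>q v\<close> the vertex \<open>q\<close> decides whether the
  value lies in \<open>H t A\<close>: if \<open>q\<close> is in \<open>H t b\<close>, then
  \<open>q v\<close> is in \<open>H t b v\<close>. So each admissible \<open>q\<close> contributes
  the set \<open>reached q\<close>, translated by the class of \<open>b\<close> and closed upwards
  in the weight.\<close>

lemma semilinear_weight_region: "L.semilinear weight_region"
proof -
  define Q where "Q = {q \<in> R. \<exists>b\<in>A. q \<in> right_coset b}"
  have "\<forall>q\<in>Q. \<exists>b. b \<in> A \<and> q \<in> right_coset b" by (auto simp: Q_def)
  then obtain b where b: "\<forall>q\<in>Q. b q \<in> A \<and> q \<in> right_coset (b q)"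
    by (rule bchoice[THEN exE])
  let ?X = "\<lambda>q. {(cls (b q), 0)} <#>\<^bsub>L\<^esub> (reached q <#>\<^bsub>L\<^esub> L.gen [(cls \<one>, 1)])"
  have "weight_region \<subseteq> (\<Union>q\<in>Q. ?X q)"
  proof
    fix x assume "x \<in> weight_region"
    then obtain a n w where x: "x = (cls a, n)" "a \<in> A" and w: "w \<in> lists S"
      "word_eval G w \<in> right_coset a" "word_weight \<omega> w \<le> n"
      by (auto simp: weight_region_def)
    obtain q v where q: "q \<in> R" "v \<in> A" "(cls v, word_weight \<omega> w) \<in> reached q"
      "word_eval G w = q \<otimes> v"
      using reached_of_word[OF w(1)] by blast
    have c: "q \<in> carrier G" "v \<in> carrier G" "a \<in> carrier G" "inv v \<in> A" "a \<otimes> inv v \<in> A"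
      using q x R_closed A_closed subgroup.m_inv_closed[OF A] subgroup.m_closed[OF A] by auto
    \<comment> \<open>Right multiplication by \<open>A\<close> preserves the double coset, so
      \<open>q\<close> lies in it together with the value of the word.\<close>
    have "q = word_eval G w \<otimes> inv v" using c q(4) by (simp add: m_assoc)
    then have "q \<in> right_coset (a \<otimes> inv v)" using right_coset_translate[OF w(2) x(2) c(4)] by simp
    then have "q \<in> Q" using q(1) c(5) by (auto simp: Q_def)
    then have bq: "b q \<in> A" "q \<in> right_coset (b q)" using b by auto
    have bv: "b q \<otimes> v \<in> A" using subgroup.m_closed[OF A] bq q by blast
    have "word_eval G w \<in> right_coset (b q \<otimes> v)"
      using right_coset_translate[OF bq(2,1) q(2)] q(4) by simp
    then have "cls a = cls (b q \<otimes> v)"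
      using right_coset_eqI[OF w(2)] x(2) bv cls_eq_iff by simp
    \<comment> \<open>The last factor pads the weight of the word up to \<open>n\<close>; the
      subtraction is exact because the word weighs at most \<open>n\<close>.\<close>
    then have "x = (cls (b q), 0) \<otimes>\<^bsub>L\<^esub>
        ((cls v, word_weight \<omega> w) \<otimes>\<^bsub>L\<^esub> (cls \<one>, n - word_weight \<omega> w))"
      using x w(3) bq(1) q(2) one_in_A A_closed by (simp add: cls_mult)
    moreover have "(cls \<one>, n - word_weight \<omega> w) \<in> L.gen [(cls \<one>, 1)]"
      unfolding gen_degree_one by blast
    ultimately have "x \<in> ?X q" using q(3)
      unfolding L.mem_set_mult L.bex_set_mult by blast
    then show "x \<in> (\<Union>q\<in>Q. ?X q)" using \<open>q \<in> Q\<close> by blast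
  qed
  moreover have "?X q \<subseteq> weight_region" if "q \<in> Q" for q
  proof
    fix x assume "x \<in> ?X q"
    then obtain y k where y: "y \<in> reached q"
      and x: "x = (cls (b q), 0) \<otimes>\<^bsub>L\<^esub> (y \<otimes>\<^bsub>L\<^esub> (cls \<one>, k))"
      unfolding gen_degree_one L.mem_set_mult L.bex_set_mult by blast
    obtain w v where w: "w \<in> lists S" "v \<in> A" "y = (cls v, word_weight \<omega> w)"
      "word_eval G w = q \<otimes> v" using word_of_reached[OF y] by blast
    have bq: "b q \<in> A" "q \<in> right_coset (b q)" using b that by auto
    have "x = (cls (b q \<otimes> v), word_weight \<omega> w + k)"
      using w(2,3) bq(1) one_in_A A_closed by (simp add: x cls_mult)
    moreover have "word_eval G w \<in> right_coset (b q \<otimes> v)"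
      using right_coset_translate[OF bq(2,1) w(2)] w(4) by simp
    moreover have "b q \<otimes> v \<in> A" using subgroup.m_closed[OF A] bq w by blast
    ultimately show "x \<in> weight_region"
      using w(1) le_add1 unfolding weight_region_def by blast
  qed
  ultimately have "weight_region = (\<Union>q\<in>Q. ?X q)" by blast
  moreover have "L.semilinear (?X q)" if "q \<in> Q" for q
  proof -
    have "L.semilinear {(cls (b q), 0)}"
      using b that by (intro L.semilinear_finite) (auto simp: carrier_quotient)
    moreover have "L.semilinear (L.gen [(cls \<one>, 1)])"
      by (rule L.semilinear_gen[OF positive_degree_one])
    ultimately show ?thesis using semilinear_reached L.semilinear_set_mult by blast
  qed
  moreover have "finite Q" using R_finite by (simp add: Q_def)
  ultimately show ?thesis using L.semilinear_UN[of Q ?X] by simp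
qed

lemma coset_weight_region:
  assumes "a \<in> A"
  shows "coset_weight G S \<omega> (right_coset a) \<le> n \<longleftrightarrow> (cls a, n) \<in> weight_region"
proof -
  have "coset_weight G S \<omega> (right_coset a) \<le> n \<longleftrightarrow>
      (\<exists>w\<in>lists S. word_eval G w \<in> right_coset a \<and> word_weight \<omega> w \<le> n)"
    using assms by (intro coset_weight_le_iff S right_coset_nonempty right_coset_closed)
  \<comment> \<open>Membership in the region provides some representative of the class, perhaps not
    \<open>a\<close>, but with the same right coset.\<close>
  also have "\<dots> \<longleftrightarrow> (cls a, n) \<in> weight_region"
    using assms cls_eq_iff[OF assms] by (auto simp: weight_region_def)
  finally show ?thesis .
qed

lemma light_cosets_bij:
  "\<exists>f. bij_betw f {x \<in> weight_region. snd x = n}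
    {C \<in> right_coset ` A. coset_weight G S \<omega> C \<le> n}"
proof -
  define X where "X = {a \<in> A. (cls a, n) \<in> weight_region}"
  have "{x \<in> weight_region. snd x = n} = (\<lambda>a. (cls a, n)) ` X"
  proof
    show "{x \<in> weight_region. snd x = n} \<subseteq> (\<lambda>a. (cls a, n)) ` X"
    proof
      fix x assume x: "x \<in> {x \<in> weight_region. snd x = n}"
      then obtain a where "a \<in> A" "x = (cls a, n)" by (auto simp: weight_region_def)
      then show "x \<in> (\<lambda>a. (cls a, n)) ` X" using x by (simp add: X_def)
    qed
  qed (auto simp: X_def)
  moreover have "{C \<in> right_coset ` A. coset_weight G S \<omega> C \<le> n} = right_coset ` X"
    using coset_weight_region by (auto simp: X_def)
  moreover have "bij_betw (\<lambda>z. right_coset (inv_into X (\<lambda>a. (cls a, n)) z))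
      ((\<lambda>a. (cls a, n)) ` X) (right_coset ` X)"
    by (rule bij_betw_images) (use cls_eq_iff in \<open>auto simp: X_def\<close>)
  ultimately show ?thesis by metis
qed

text \<open>Finiteness is inherited from the region: as a semilinear set with periods of positive
  degree it has finitely many elements in each degree.\<close>

lemma finite_light_cosets: "finite {C \<in> right_coset ` A. coset_weight G S \<omega> C \<le> n}"
proof -
  have "finite {x \<in> weight_region. snd x = n}"
    using L.semilinear_fin_degrees[OF semilinear_weight_region] by (simp add: L.fin_degrees_def)
  then show ?thesis using light_cosets_bij[of n] bij_betw_finite by blast
qed

lemma rational_double_coset_series:
  "rational_fps (Abs_fps (\<lambda>n.
     of_nat (card {C \<in> right_coset ` A. coset_weight G S \<omega> C = n})))" (is "rational_fps ?F")
proof -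
  let ?s = "\<lambda>P. {C \<in> right_coset ` A. P (coset_weight G S \<omega> C)}"
  have le: "card {x \<in> weight_region. snd x = n} = card (?s (\<lambda>k. k \<le> n))" for n
    using light_cosets_bij[of n] bij_betw_same_card by blast
  have step: "card (?s (\<lambda>k. k \<le> Suc n)) = card (?s (\<lambda>k. k \<le> n)) + card (?s (\<lambda>k. k = Suc n))" for n
  proof -
    have split: "?s (\<lambda>k. k \<le> Suc n) = ?s (\<lambda>k. k \<le> n) \<union> ?s (\<lambda>k. k = Suc n)"
      by (auto simp: le_Suc_eq)
    moreover have "finite (?s (\<lambda>k. k = Suc n))"
      by (rule finite_subset[OF _ finite_light_cosets[of "Suc n"]]) auto
    ultimately show ?thesis using finite_light_cosets[of n] by (auto intro!: card_Un_disjoint)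
  qed
  \<comment> \<open>The factor takes differences of consecutive cumulative counts; at
    \<open>n = 0\<close> weight at most 0 already means weight 0.\<close>
  have "?F = (1 - fps_X ^ 1) * L.gf weight_region"
  proof (rule fps_ext)
    fix n
    show "fps_nth ?F n = fps_nth ((1 - fps_X ^ 1) * L.gf weight_region) n"
      by (cases n) (simp_all add: le step left_diff_distrib)
  qed
  moreover have "rational_fps ((1 - fps_X ^ 1) * L.gf weight_region)"
    using rational_fps_poly[of "1 - monom 1 1"]
    by (intro rational_fps_mult L.rational_gf_semilinear semilinear_weight_region)
      (simp only: rat_fps_of_poly_one_minus_monom)
  ultimately show ?thesis by simp
qed

end

text \<open>Finite index is given for right cosets, while the factorization concerns left cosets;
  inversion exchanges the two, so inverses of representatives are taken.\<close>

lemma (in group) exists_transversal: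
  assumes A: "subgroup A G" and "finite (rcosets A)"
  shows "\<exists>R. finite R \<and> R \<subseteq> carrier G \<and> \<one> \<in> R \<and>
    (\<forall>g\<in>carrier G. \<exists>r\<in>R. \<exists>a\<in>A. g = r \<otimes> a)"
proof -
  define x where "x C = (SOME y. y \<in> C)" for C :: "'a set"
  have x: "x (A #> g) \<in> A #> g" if "g \<in> carrier G" for g
    unfolding x_def by (rule someI) (rule rcos_self[OF that A])
  have xc: "x (A #> g) \<in> carrier G" if "g \<in> carrier G" for g
    using x[OF that] r_coset_subset_G[OF subgroup.subset[OF A] that] by blast
  \<comment> \<open>The identity is added because walks start there, at the price of possibly
    meeting one coset twice.\<close>
  define R where "R = insert \<one> ((\<lambda>C. inv (x C)) ` (rcosets A))"
  have "\<exists>r\<in>R. \<exists>a\<in>A. g = r \<otimes> a" if g: "g \<in> carrier G" for g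
  proof -
    let ?y = "x (A #> inv g)"
    obtain a where a: "a \<in> A" "?y = a \<otimes> inv g"
      using x[of "inv g"] g by (auto simp: r_coset_def)
    have ac: "a \<in> carrier G" using a subgroup.subset[OF A] by blast
    have "inv ?y \<otimes> a = g" using ac g by (simp add: a(2) inv_mult_group m_assoc)
    moreover have "inv ?y \<in> R"
      using g by (auto simp: R_def RCOSETS_def)
    ultimately show ?thesis using a(1) by metis
  qed
  moreover have "finite R" "\<one> \<in> R" using assms(2) by (auto simp: R_def)
  moreover have "R \<subseteq> carrier G" using xc by (auto simp: R_def RCOSETS_def)
  ultimately show ?thesis by blast
qed

theorem theorem2:
  fixes G :: "('a, 'b) monoid_scheme" and H S :: "'a set" and \<omega> :: "'a \<Rightarrow> nat"
  assumes "group G"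
    and "virtually_abelian G"
    and "subgroup H G"
    and "finite_generating_set G S"
    and "\<forall>s \<in> S. \<omega> s \<ge> 1"
  shows "rational_fps (coset_growth_series G H S \<omega>)"
proof -
  interpret group G by fact
  obtain A where A: "subgroup A G" "comm_group (G\<lparr>carrier := A\<rparr>)" "finite (rcosets\<^bsub>G\<^esub> A)"
    using assms(2) unfolding virtually_abelian_def by blast
  obtain R where R: "finite R" "R \<subseteq> carrier G" "\<one>\<^bsub>G\<^esub> \<in> R"
    "\<forall>g\<in>carrier G. \<exists>r\<in>R. \<exists>a\<in>A. g = r \<otimes>\<^bsub>G\<^esub> a"
    using exists_transversal[OF A(1,3)] by blast
  have loc: "weighted_double_coset G A R H t S \<omega>" if "t \<in> carrier G" for t
    by (intro weighted_double_coset.intro double_coset.intro transversal.intro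
        transversal_axioms.intro double_coset_axioms.intro weighted_double_coset_axioms.intro)
      (use A R assms that in \<open>auto simp: Suc_le_eq\<close>)
  have AG: "a \<in> carrier G" if "a \<in> A" for a using that subgroup.subset[OF A(1)] by blast
  have HG: "H \<subseteq> carrier G" by (rule subgroup.subset[OF assms(3)])
  \<comment> \<open>\<open>\<kappa> r\<close> is the set of right cosets of \<open>H\<close>
    contained in the double coset \<open>H r A\<close>.\<close>
  define \<kappa> where "\<kappa> r = (\<lambda>a. H #>\<^bsub>G\<^esub> (r \<otimes>\<^bsub>G\<^esub> a)) ` A" for r
  have cover: "rcosets\<^bsub>G\<^esub> H = \<Union>(\<kappa> ` R)"
  proof
    show "rcosets\<^bsub>G\<^esub> H \<subseteq> \<Union>(\<kappa> ` R)"
      using R(4) by (fastforce simp: RCOSETS_def \<kappa>_def)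
    show "\<Union>(\<kappa> ` R) \<subseteq> rcosets\<^bsub>G\<^esub> H"
      using R(2) AG by (auto simp: \<kappa>_def intro!: rcosetsI[OF HG] m_closed)
  qed
  \<comment> \<open>Double cosets are equal or disjoint: right translation by \<open>a^-1 d\<close>
    carries the common coset \<open>C\<close> to \<open>D\<close>, and it preserves
    \<open>\<kappa> r'\<close>.\<close>
  have sub: "\<kappa> r \<subseteq> \<kappa> r'" if r: "r \<in> R" "r' \<in> R" and C: "C \<in> \<kappa> r" "C \<in> \<kappa> r'" for r r' C
  proof
    obtain a a' where a: "a \<in> A" "C = H #>\<^bsub>G\<^esub> (r \<otimes>\<^bsub>G\<^esub> a)" "a' \<in> A" "C = H #>\<^bsub>G\<^esub> (r' \<otimes>\<^bsub>G\<^esub> a')"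
      using C by (auto simp: \<kappa>_def)
    fix D assume "D \<in> \<kappa> r"
    then obtain d where d: "d \<in> A" "D = H #>\<^bsub>G\<^esub> (r \<otimes>\<^bsub>G\<^esub> d)" by (auto simp: \<kappa>_def)
    let ?e = "inv\<^bsub>G\<^esub> a \<otimes>\<^bsub>G\<^esub> d"
    have c: "r \<in> carrier G" "r' \<in> carrier G" "a \<in> carrier G" "a' \<in> carrier G" "d \<in> carrier G"
      using r R(2) a d AG by auto
    have "a \<otimes>\<^bsub>G\<^esub> ?e = d" using c by (simp flip: m_assoc)
    then have "r \<otimes>\<^bsub>G\<^esub> d = (r \<otimes>\<^bsub>G\<^esub> a) \<otimes>\<^bsub>G\<^esub> ?e" using c by (simp add: m_assoc)
    then have "D = C #>\<^bsub>G\<^esub> ?e" using a(2) d(2) c HG by (simp add: coset_mult_assoc)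
    also have "\<dots> = H #>\<^bsub>G\<^esub> (r' \<otimes>\<^bsub>G\<^esub> (a' \<otimes>\<^bsub>G\<^esub> ?e))"
      using a(4) c HG by (simp add: coset_mult_assoc m_assoc)
    finally show "D \<in> \<kappa> r'"
      using a d subgroup.m_closed[OF A(1)] subgroup.m_inv_closed[OF A(1)] by (auto simp: \<kappa>_def)
  qed
  have disj: "X \<inter> Y = {}" if "X \<in> \<kappa> ` R" "Y \<in> \<kappa> ` R" "X \<noteq> Y" for X Y
    using that sub by blast
  let ?s = "\<lambda>X n. {C \<in> X. coset_weight G S \<omega> C = n}"
  have fin: "finite (?s X n)" if X: "X \<in> \<kappa> ` R" for X n
  proof -
    obtain t where tR: "t \<in> R" "X = \<kappa> t" using X by blast
    interpret weighted_double_coset G A R H t S \<omega> using loc tR R(2) by blast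
    show ?thesis
      by (rule finite_subset[OF _ finite_light_cosets[of n]]) (auto simp: tR(2) \<kappa>_def)
  qed
  \<comment> \<open>The sum runs over the image of \<open>R\<close>, not over \<open>R\<close>,
    since several representatives may give the same double coset.\<close>
  have "card (?s (rcosets\<^bsub>G\<^esub> H) n) = (\<Sum>X\<in>\<kappa> ` R. card (?s X n))" for n
  proof -
    have "?s (rcosets\<^bsub>G\<^esub> H) n = (\<Union>X\<in>\<kappa> ` R. ?s X n)" unfolding cover by blast
    also have "card \<dots> = (\<Sum>X\<in>\<kappa> ` R. card (?s X n))"
      using R(1) fin disj by (intro card_UN_disjoint) blast+
    finally show ?thesis .
  qed
  then have "coset_growth_series G H S \<omega> = (\<Sum>X\<in>\<kappa> ` R. Abs_fps (\<lambda>n. of_nat (card (?s X n))))"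
    by (intro fps_ext) (simp add: coset_growth_series_def fps_sum_nth)
  also have "rational_fps \<dots>"
  proof (rule rational_fps_sum)
    fix X assume "X \<in> \<kappa> ` R"
    then obtain t where tR: "t \<in> R" "X = \<kappa> t" by blast
    interpret weighted_double_coset G A R H t S \<omega> using loc tR R(2) by blast
    show "rational_fps (Abs_fps (\<lambda>n. of_nat (card (?s X n))))"
      unfolding tR(2) \<kappa>_def by (rule rational_double_coset_series)
  qed
  finally show ?thesis .
qed

end
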